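(* Let $n\ge2$, $p\in[2,\infty)$ and let $\omega$ be a majorant. Suppose that $\lambda:\mathbb{B}^n\to[0,\infty)$ is continuous, let $\lambda_2(t)=\sup_{|x|=t}\lambda(x)$ for $t\in[0,1)$ (a nonnegative continuous function on $[0,1)$), and suppose that for every $r\in[0,1)$, $$\int_0^r\frac{\rho^{n-1}g_n(\rho,r)\lambda_2(\rho)}{(1-\rho^2)^n}\,d\rho<\frac1{np},\qquad\text{where } g_n(\rho,r)=\frac1n\int_\rho^r\frac{(1-s^2)^{n-2}}{s^{n-1}}\,ds.$$ Let $C>0$. Then there is a positive constant $C'$, depending only on $C$, with the following property. If $f\in C^2(\mathbb{B}^n)$ is real-valued, satisfies $$\Delta_hf(x)=\lambda(x)f(x),\quad x\in\mathbb{B}^n,$$ and $$M_p(r,\nabla f)\le C\,\omega\left(\frac1{1-r}\right)\quad\text{for all } r\in[0,1),$$ then for all $r\in[0,1)$, $$M_p(r,f)\le\frac1{\sqrt{C_1(r)}}\left[|f(0)|^2+\frac{2^{n-2}p\,C'\omega(1)(p-1)}{n-1}\int_0^r\omega\left(\frac1{1-\rho}\right)d\rho\right]^{\frac12},$$ where $$C_1(r)=1-np\int_0^r\frac{\rho^{n-1}g_n(\rho,r)\lambda_2(\rho)}{(1-\rho^2)^n}\,d\rho.$$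
   Context: $\mathbb{B}^n$ and $\mathbb{S}^{n-1}$ are the open unit ball and unit sphere of $\mathbb{R}^n$; $\sigma$ is the normalized surface measure on $\mathbb{S}^{n-1}$. A majorant is a continuous increasing function $\omega:[0,\infty)\to[0,\infty)$ with $\omega(0)=0$ such that $\omega(t)/t$ is non-increasing for $t>0$. For $f$ on $\mathbb{B}^n$ with values in some $\mathbb{R}^\nu$ and measurable, $M_p(r,f)=\left(\int_{\mathbb{S}^{n-1}}|f(r\zeta)|^p\,d\sigma(\zeta)\right)^{1/p}$. The Möbius invariant (hyperbolic) Laplacian is $$\Delta_hf(x)=(1-|x|^2)\left[(1-|x|^2)\Delta f(x)+2(n-2)\langle\nabla f(x),x\rangle\right],$$ with $\Delta$ the Euclidean Laplacian. *)

theory Defs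
  imports "HOL-Analysis.Analysis"
begin

text \<open>
  The dimension is quantified inside the theorem, so \<open>\<real>\<^sup>n\<close> is not a type \<open>real ^ 'n\<close> but the
  carrier of the library's \<^const>\<open>Euclidean_space\<close> \<open>n\<close>: functions \<open>x :: nat \<Rightarrow> real\<close> with
  \<open>x i = 0\<close> for all \<open>i \<ge> n\<close>.  The product topology of the function type induces the usual
  topology on this carrier.  Values of \<open>f\<close> and \<open>\<lambda>\<close> outside the open unit ball are never used.
\<close>

abbreviation Rn :: "nat \<Rightarrow> (nat \<Rightarrow> real) set" where
  "Rn n \<equiv> topspace (Euclidean_space n)"

definition vnorm :: "nat \<Rightarrow> (nat \<Rightarrow> real) \<Rightarrow> real" where
  "vnorm n x = L2_set x {..<n}"

definition vinner :: "nat \<Rightarrow> (nat \<Rightarrow> real) \<Rightarrow> (nat \<Rightarrow> real) \<Rightarrow> real" where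
  "vinner n x y = (\<Sum>i<n. x i * y i)"

definition vscale :: "real \<Rightarrow> (nat \<Rightarrow> real) \<Rightarrow> (nat \<Rightarrow> real)" where
  "vscale c x = (\<lambda>i. c * x i)"

definition unit_ball :: "nat \<Rightarrow> (nat \<Rightarrow> real) set" where
  "unit_ball n = {x \<in> Rn n. vnorm n x < 1}"

definition unit_sphere :: "nat \<Rightarrow> (nat \<Rightarrow> real) set" where
  "unit_sphere n = {x \<in> Rn n. vnorm n x = 1}"

definition vol_Rn :: "nat \<Rightarrow> (nat \<Rightarrow> real) measure" where
  "vol_Rn n = distr (PiM {..<n} (\<lambda>_. lborel)) borel (\<lambda>x i. if i < n then x i else 0)"

text \<open>
  Normalized surface measure on the sphere \<open>S\<^bsup>n-1\<^esup>\<close>: the image of the normalized volume of the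
  unit ball under \<open>x \<mapsto> x / \<bar>x\<bar>\<close>, that is,
  \<open>\<sigma>(A) = vol {t\<zeta> | \<zeta> \<in> A, 0 < t < 1} / vol (unit_ball n)\<close>.  The map sends \<open>0\<close> to \<open>0\<close>, which is a
  null set for \<open>n \<ge> 1\<close> and is removed by the restriction to the sphere.
\<close>

definition sphere_measure :: "nat \<Rightarrow> (nat \<Rightarrow> real) measure" where
  "sphere_measure n =
     restrict_space
       (distr (uniform_measure (vol_Rn n) (unit_ball n)) borel (\<lambda>x. vscale (1 / vnorm n x) x))
       (unit_sphere n)"

text \<open>
  \<open>M\<^sub>p(r, f)\<close> for \<open>f\<close> with values in a space whose norm is \<open>N\<close>: \<^const>\<open>abs\<close> for scalar \<open>f\<close>,
  \<open>vnorm n\<close> for the gradient.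
\<close>

definition Mp :: "nat \<Rightarrow> ('a \<Rightarrow> real) \<Rightarrow> real \<Rightarrow> real \<Rightarrow> ((nat \<Rightarrow> real) \<Rightarrow> 'a) \<Rightarrow> real" where
  "Mp n N p r f = (LINT \<zeta>|sphere_measure n. N (f (vscale r \<zeta>)) powr p) powr (1 / p)"

definition partial :: "nat \<Rightarrow> ((nat \<Rightarrow> real) \<Rightarrow> real) \<Rightarrow> (nat \<Rightarrow> real) \<Rightarrow> real" where
  "partial i f x = deriv (\<lambda>t. f (x(i := t))) (x i)"

primrec Ck_on :: "nat \<Rightarrow> nat \<Rightarrow> (nat \<Rightarrow> real) set \<Rightarrow> ((nat \<Rightarrow> real) \<Rightarrow> real) \<Rightarrow> bool" where
  "Ck_on n 0 U f \<longleftrightarrow> continuous_on U f"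
| "Ck_on n (Suc k) U f \<longleftrightarrow> continuous_on U f \<and>
     (\<forall>i<n. (\<forall>x\<in>U. (\<lambda>t. f (x(i := t))) differentiable (at (x i))) \<and> Ck_on n k U (partial i f))"

definition grad :: "nat \<Rightarrow> ((nat \<Rightarrow> real) \<Rightarrow> real) \<Rightarrow> (nat \<Rightarrow> real) \<Rightarrow> (nat \<Rightarrow> real)" where
  "grad n f x = (\<lambda>i. if i < n then partial i f x else 0)"

definition laplacian :: "nat \<Rightarrow> ((nat \<Rightarrow> real) \<Rightarrow> real) \<Rightarrow> (nat \<Rightarrow> real) \<Rightarrow> real" where
  "laplacian n f x = (\<Sum>i<n. partial i (partial i f) x)"

definition hyp_laplacian :: "nat \<Rightarrow> ((nat \<Rightarrow> real) \<Rightarrow> real) \<Rightarrow> (nat \<Rightarrow> real) \<Rightarrow> real" where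
  "hyp_laplacian n f x =
     (1 - (vnorm n x)\<^sup>2) *
     ((1 - (vnorm n x)\<^sup>2) * laplacian n f x + 2 * (real n - 2) * vinner n (grad n f x) x)"

text \<open>``Increasing'' is read as non-decreasing; only the values on \<open>[0, \<infinity>)\<close> matter.\<close>

definition majorant :: "(real \<Rightarrow> real) \<Rightarrow> bool" where
  "majorant \<omega> \<longleftrightarrow>
     continuous_on {0..} \<omega> \<and> mono_on {0..} \<omega> \<and> (\<forall>t\<ge>0. 0 \<le> \<omega> t) \<and> \<omega> 0 = 0 \<and>
     antimono_on {0<..} (\<lambda>t. \<omega> t / t)"

definition radial_sup :: "nat \<Rightarrow> ((nat \<Rightarrow> real) \<Rightarrow> real) \<Rightarrow> real \<Rightarrow> real" where
  "radial_sup n l t = (SUP x\<in>{x \<in> Rn n. vnorm n x = t}. l x)"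

definition hyp_green :: "nat \<Rightarrow> real \<Rightarrow> real \<Rightarrow> real" where
  "hyp_green n \<rho> r = 1 / real n * integral {\<rho>..r} (\<lambda>s. (1 - s\<^sup>2) ^ (n - 2) / s ^ (n - 1))"

definition green_potential :: "nat \<Rightarrow> ((nat \<Rightarrow> real) \<Rightarrow> real) \<Rightarrow> real \<Rightarrow> real" where
  "green_potential n l r =
     integral {0..r} (\<lambda>\<rho>. \<rho> ^ (n - 1) * hyp_green n \<rho> r * radial_sup n l \<rho> / (1 - \<rho>\<^sup>2) ^ n)"

definition C1 :: "nat \<Rightarrow> real \<Rightarrow> ((nat \<Rightarrow> real) \<Rightarrow> real) \<Rightarrow> real \<Rightarrow> real" where
  "C1 n p l r = 1 - real n * p * green_potential n l r"

end

theory Submission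
  imports Defs
begin

text \<open>
  Let \<open>\<mu>(s)\<close> be the mean of \<open>u = \<bar>f\<bar>\<^sup>p\<close> over the sphere of radius \<open>s\<close>.  The field
  \<open>(1 - \<bar>x\<bar>\<^sup>2)\<^bsup>2-n\<^esup> \<nabla>u\<close> has divergence \<open>(1 - \<bar>x\<bar>\<^sup>2)\<^bsup>-n\<^esup> \<Delta>\<^sub>h u \<ge> 0\<close>, so the divergence theorem on balls shows
  that \<open>\<mu>\<close> increases and that \<open>\<mu>(r) - u(0)\<close> is the integral of \<open>\<Delta>\<^sub>h u\<close> against the Green function.  Here
  \<open>\<Delta>\<^sub>h u = p(p-1) (1 - \<bar>x\<bar>\<^sup>2)\<^sup>2 \<bar>f\<bar>\<^bsup>p-2\<^esup> \<bar>\<nabla>f\<bar>\<^sup>2 + p \<lambda> \<bar>f\<bar>\<^sup>p\<close>; the second term is absorbed into \<open>C\<^sub>1(r)\<close> because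
  \<open>\<mu>(s) \<le> \<mu>(r)\<close>, and the first is controlled by the hypothesis on \<open>\<nabla>f\<close>, by
  \<open>n s\<^bsup>n-1\<^esup> g\<^sub>n(s,r) (1 - s\<^sup>2)\<^bsup>2-n\<^esup> \<le> (1 - s) / (n - 1)\<close> and by \<open>(1 - s) \<omega>(1/(1-s)) \<le> \<omega>(1)\<close>.  One may take \<open>C' = C\<^sup>2\<close>.

  The divergence theorem itself comes from Fubini in each coordinate: cut off by \<open>R\<^sup>2 - \<bar>x\<bar>\<^sup>2\<close>, a derivative
  integrates to zero over every chord of the ball; differentiating the resulting identity in \<open>R\<close> yields the
  boundary term.
\<close>

subsection \<open>Balls and spheres in the coordinate space\<close>

text \<open>The surface measure is given as an image of ball volume, without charts. All facts about
  spheres are therefore read off from the scaling of volume: a spherical mean appears as the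
  derivative in R of an integral over the ball of radius R. This is why the divergence theorem is
  first obtained with ball integrals only. The weight \<open>(1 - |x|^2)^(2-n)\<close> is dictated
  by the equation: its i-th derivative \<open>2 (n-2) x_i (1 - |x|^2)^(1-n)\<close> reproduces the
  first-order term of the hyperbolic Laplacian. Write m for the p-mean of f at the outer radius r.
  Every mean over a smaller radius s is estimated through m, so that \<open>m^(p-2)\<close> leaves
  the integral over s. The outcome has the form \<open>C1(r) m^p <= |f(0)|^p + m^(p-2) B\<close>.
  Since \<open>|f(0)| <= m\<close>, the first term is at most \<open>m^(p-2) |f(0)|^2\<close>;
  division by \<open>m^(p-2)\<close> leaves \<open>m^2\<close>, and this is the origin of the square
  root in the result.\<close>

definition oball :: "nat \<Rightarrow> real \<Rightarrow> (nat \<Rightarrow> real) set" where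
  "oball n R = {x \<in> Rn n. vnorm n x < R}"

definition kball :: "nat \<Rightarrow> real \<Rightarrow> (nat \<Rightarrow> real) set" where
  "kball n R = {x \<in> Rn n. vnorm n x \<le> R}"

lemma unit_ball_eq_oball: "unit_ball n = oball n 1"
  by (simp add: unit_ball_def oball_def)

lemma kball_subset_unit_ball: "R < 1 \<Longrightarrow> kball n R \<subseteq> unit_ball n"
  by (auto simp: unit_ball_def kball_def)

lemma oball_subset_kball: "oball n R \<subseteq> kball n R"
  by (auto simp: oball_def kball_def)

lemma oball_subset_unit_ball: "R \<le> 1 \<Longrightarrow> oball n R \<subseteq> unit_ball n"
  by (auto simp: unit_ball_def oball_def)

lemma vnorm_nonneg [simp]: "0 \<le> vnorm n x"
  by (simp add: vnorm_def)

lemma vnorm_square: "(vnorm n x)\<^sup>2 = (\<Sum>i<n. (x i)\<^sup>2)"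
  by (simp add: vnorm_def L2_set_def sum_nonneg)

lemma vnorm_vscale: "vnorm n (vscale c x) = \<bar>c\<bar> * vnorm n x"
proof -
  have "(vnorm n (vscale c x))\<^sup>2 = (\<bar>c\<bar> * vnorm n x)\<^sup>2"
    by (simp add: vnorm_square power_mult_distrib vscale_def sum_distrib_left)
  then show ?thesis
    by (simp add: power2_eq_iff_nonneg)
qed

lemma vnorm_zero [simp]: "vnorm n (\<lambda>_. 0) = 0"
  by (simp add: vnorm_def L2_set_def)

lemma component_le_vnorm: "i < n \<Longrightarrow> \<bar>x i\<bar> \<le> vnorm n x"
proof -
  assume "i < n"
  then have "(x i)\<^sup>2 \<le> (\<Sum>j<n. (x j)\<^sup>2)"
    by (intro member_le_sum) auto
  then show ?thesis
    unfolding vnorm_square[symmetric] by (simp add: abs_le_square_iff[symmetric])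
qed

lemma vnorm_eq_0_iff: "x \<in> Rn n \<Longrightarrow> vnorm n x = 0 \<longleftrightarrow> x = (\<lambda>_. 0)"
  by (auto simp: vnorm_def L2_set_eq_0_iff topspace_Euclidean_space fun_eq_iff)
     (metis lessThan_iff not_less)

lemma vscale_in_Rn: "x \<in> Rn n \<Longrightarrow> vscale c x \<in> Rn n"
  by (simp add: topspace_Euclidean_space vscale_def)

lemma vscale_vscale [simp]: "vscale a (vscale b x) = vscale (a * b) x"
  by (simp add: vscale_def mult.assoc)

lemma vscale_1 [simp]: "vscale 1 x = x"
  by (simp add: vscale_def)

lemma vscale_0 [simp]: "vscale 0 x = (\<lambda>_. 0)"
  by (simp add: vscale_def)

lemma vscale_unit_sphere_in_unit_ball:
  "z \<in> unit_sphere n \<Longrightarrow> s \<in> {0..<1} \<Longrightarrow> vscale s z \<in> unit_ball n"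
  by (simp add: unit_sphere_def unit_ball_def vnorm_vscale vscale_in_Rn)

lemma continuous_on_vnorm [continuous_intros]:
  "continuous_on A g \<Longrightarrow> continuous_on A (\<lambda>x. vnorm n (g x))"
  unfolding vnorm_def L2_set_def
  by (intro continuous_intros) (auto intro: continuous_on_product_then_coordinatewise)

lemma continuous_on_vscale [continuous_intros]:
  "continuous_on A c \<Longrightarrow> continuous_on A g \<Longrightarrow> continuous_on A (\<lambda>x. vscale (c x) (g x))"
  unfolding vscale_def
  by (intro continuous_intros) (auto intro: continuous_on_product_then_coordinatewise)

lemma closed_Rn: "closed (Rn n)"
  using closedin_Euclidean_space[of n] by (simp add: euclidean_product_topology)

text \<open>Tychonoff: the ball is a closed subset of a product of compact factors,
  \<open>{-R..R}\<close> in the first n coordinates and \<open>{0}\<close> in all others.\<close>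

lemma compact_kball: "compact (kball n R)"
proof -
  have "compactin (product_topology (\<lambda>_. euclidean) UNIV)
          (PiE UNIV (\<lambda>i::nat. if i < n then {-R..R} else {0::real}))"
    by (subst compactin_PiE) auto
  then have "compact (PiE UNIV (\<lambda>i::nat. if i < n then {-R..R} else {0::real}))"
    by (simp add: euclidean_product_topology)
  moreover have "closed (kball n R)"
  proof -
    have "kball n R = Rn n \<inter> {x. vnorm n x \<le> R}"
      by (auto simp: kball_def)
    then show ?thesis
      by (simp add: closed_Int closed_Rn closed_Collect_le continuous_on_vnorm)
  qed
  moreover have "kball n R \<subseteq> PiE UNIV (\<lambda>i::nat. if i < n then {-R..R} else {0::real})"
  proof
    fix x assume x: "x \<in> kball n R"
    then have "\<bar>x i\<bar> \<le> R" if "i < n" for i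
      using component_le_vnorm[OF that, of x] by (simp add: kball_def)
    then show "x \<in> PiE UNIV (\<lambda>i::nat. if i < n then {-R..R} else {0::real})"
      using x by (force simp: kball_def topspace_Euclidean_space not_less)
  qed
  ultimately show ?thesis
    by (metis compact_Int_closed inf.absorb2)
qed

lemma closed_unit_sphere: "closed (unit_sphere n)"
proof -
  have "unit_sphere n = Rn n \<inter> {x. vnorm n x = 1}"
    by (auto simp: unit_sphere_def)
  then show ?thesis
    by (simp add: closed_Int closed_Rn closed_Collect_eq continuous_on_vnorm)
qed

lemma compact_unit_sphere: "compact (unit_sphere n)"
proof -
  have "kball n 1 \<inter> unit_sphere n = unit_sphere n"
    by (auto simp: kball_def unit_sphere_def)
  then show ?thesis
    using compact_Int_closed[OF compact_kball closed_unit_sphere, of n 1 n] by simp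
qed

lemma borel_oball [measurable]: "oball n R \<in> sets borel"
proof -
  have "oball n R = Rn n \<inter> {x. vnorm n x < R}"
    by (auto simp: oball_def)
  then show ?thesis
    by (simp add: sets.Int borel_closed closed_Rn borel_open open_Collect_less continuous_on_vnorm)
qed

lemma borel_unit_sphere [measurable]: "unit_sphere n \<in> sets borel"
  using closed_unit_sphere by (rule borel_closed)

lemma measurable_vnorm [measurable]: "vnorm n \<in> borel_measurable borel"
  by (rule borel_measurable_continuous_onI) (intro continuous_intros)

lemma measurable_vscale_const [measurable]: "vscale c \<in> borel_measurable borel"
  by (rule borel_measurable_continuous_onI) (intro continuous_intros)

text \<open>The map is not continuous where the norm vanishes, so measurability is checked by
  coordinates, with division by 0 giving 0.\<close>

lemma measurable_radial_projection [measurable]: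
  "(\<lambda>x. vscale (1 / vnorm n x) x) \<in> borel_measurable borel"
proof -
  show ?thesis
    unfolding vscale_def
  proof (rule measurable_coordinatewise_then_product)
    show "(\<lambda>x. 1 / vnorm n x * x i) \<in> borel_measurable borel" for i
      by (intro borel_measurable_times borel_measurable_divide measurable_vnorm
          borel_measurable_const borel_measurable_continuous_onI continuous_on_product_coordinates)
  qed
qed

lemma continuous_on_kball_bounded:
  fixes w :: "(nat \<Rightarrow> real) \<Rightarrow> real"
  assumes "continuous_on (unit_ball n) w" "R < 1"
  obtains K where "0 \<le> K" "\<And>x. x \<in> kball n R \<Longrightarrow> \<bar>w x\<bar> \<le> K"
proof -
  have "compact (w ` kball n R)"
    using continuous_on_subset[OF assms(1) kball_subset_unit_ball[OF assms(2)]] compact_kball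
    by (rule compact_continuous_image)
  then have "bounded (w ` kball n R)"
    by (rule compact_imp_bounded)
  then obtain K where "\<forall>y\<in>w ` kball n R. norm y \<le> K"
    unfolding bounded_iff by blast
  then have "\<bar>w x\<bar> \<le> max 0 K" if "x \<in> kball n R" for x
    using that by (simp add: le_max_iff_disj)
  with that[of "max 0 K"] show thesis
    by simp
qed

text \<open>Compactness of \<open>{0..R} \<times> unit_sphere n\<close> makes the modulus d
  independent of the direction z. Continuity of spherical means, the shell estimate and continuity
  of the radial supremum all rest on this.\<close>

lemma uniformly_continuous_radially:
  fixes w :: "(nat \<Rightarrow> real) \<Rightarrow> real"
  assumes "continuous_on (unit_ball n) w" "R < 1" "0 < e"
  obtains d where "0 < d"
    "\<And>s s' z. s \<in> {0..R} \<Longrightarrow> s' \<in> {0..R} \<Longrightarrow> \<bar>s - s'\<bar> < d \<Longrightarrow> z \<in> unit_sphere n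
       \<Longrightarrow> \<bar>w (vscale s z) - w (vscale s' z)\<bar> < e"
proof -
  let ?g = "\<lambda>q. w (vscale (fst q) (snd q))"
  have "continuous_on ({0..R} \<times> unit_sphere n) ?g"
  proof (rule continuous_on_compose2[OF assms(1)])
    show "continuous_on ({0..R} \<times> unit_sphere n) (\<lambda>q. vscale (fst q) (snd q))"
      by (intro continuous_on_vscale continuous_on_fst continuous_on_snd continuous_on_id)
    show "(\<lambda>q. vscale (fst q) (snd q)) ` ({0..R} \<times> unit_sphere n) \<subseteq> unit_ball n"
      using vscale_unit_sphere_in_unit_ball assms(2) by (auto simp: image_subset_iff)
  qed
  then have "uniformly_continuous_on ({0..R} \<times> unit_sphere n) ?g"
    by (rule compact_uniformly_continuous) (intro compact_Times compact_unit_sphere compact_Icc)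
  then obtain d where d: "0 < d" "\<And>q q'. q \<in> {0..R} \<times> unit_sphere n \<Longrightarrow> q' \<in> {0..R} \<times> unit_sphere n
     \<Longrightarrow> dist q' q < d \<Longrightarrow> dist (?g q') (?g q) < e"
    unfolding uniformly_continuous_on_def using assms(3) by blast
  show thesis
  proof
    show "0 < d" by fact
    fix s s' z assume "s \<in> {0..R}" "s' \<in> {0..R}" "\<bar>s - s'\<bar> < d" "z \<in> unit_sphere n"
    then show "\<bar>w (vscale s z) - w (vscale s' z)\<bar> < e"
      using d(2)[of "(s', z)" "(s, z)"] by (simp add: dist_Pair_Pair dist_real_def)
  qed
qed

subsection \<open>Scaling and sections of Lebesgue measure\<close>

definition Rn_embed :: "nat \<Rightarrow> (nat \<Rightarrow> real) \<Rightarrow> (nat \<Rightarrow> real)" where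
  "Rn_embed n x = (\<lambda>i. if i < n then x i else 0)"

lemma vol_Rn_eq: "vol_Rn n = distr (PiM {..<n} (\<lambda>_. lborel)) borel (Rn_embed n)"
  by (simp add: vol_Rn_def Rn_embed_def[abs_def])

lemma measurable_Rn_embed [measurable]:
  "Rn_embed n \<in> measurable (PiM {..<n} (\<lambda>_. lborel)) borel"
  unfolding Rn_embed_def
proof (rule measurable_coordinatewise_then_product)
  show "(\<lambda>x. if i < n then x i else 0) \<in> borel_measurable (PiM {..<n} (\<lambda>_. lborel))" for i
    by (cases "i < n") simp_all
qed

lemma sets_vol_Rn [simp, measurable_cong]: "sets (vol_Rn n) = sets borel"
  and space_vol_Rn [simp]: "space (vol_Rn n) = UNIV"
  by (simp_all add: vol_Rn_def)

interpretation lborel_prod: product_sigma_finite "\<lambda>_::nat. lborel :: real measure" ..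

text \<open>Product measures are determined by boxes. There each of the n coordinates contributes a
  factor \<open>1 / c\<close>, which the density \<open>c ^ n\<close> compensates.\<close>

lemma PiM_lborel_scale:
  fixes c :: real
  assumes "0 < c"
  shows "density (distr (PiM {..<n} (\<lambda>_. lborel)) (PiM {..<n} (\<lambda>_. lborel)) (\<lambda>x. \<lambda>i\<in>{..<n}. c * x i))
           (\<lambda>_. ennreal (c ^ n)) = PiM {..<n} (\<lambda>_. lborel)" (is "density ?D _ = ?P")
proof (rule lborel_prod.PiM_eqI)
  fix A :: "nat \<Rightarrow> real set" assume A: "\<And>i. i \<in> {..<n} \<Longrightarrow> A i \<in> sets lborel"
  have m: "(\<lambda>x. \<lambda>i\<in>{..<n}. c * x i) \<in> measurable ?P ?P"
    by (intro measurable_restrict) simp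
  have s: "PiE {..<n} A \<in> sets ?P"
    using A by (intro sets_PiM_I_finite) auto
  have "emeasure lborel ((\<lambda>t. c * t) -` A i) = ennreal (inverse c) * emeasure lborel (A i)" if "i < n" for i
  proof -
    have "emeasure lborel ((\<lambda>t. c * t) -` A i) = emeasure (distr lborel borel ((*) c)) (A i)"
      using A that by (subst emeasure_distr) auto
    also have "\<dots> = emeasure (density lborel (\<lambda>_. inverse \<bar>c\<bar>)) (A i)"
      using assms lborel_distr_mult[of c] by simp
    also have "\<dots> = ennreal (inverse c) * emeasure lborel (A i)"
      using A that assms by (subst emeasure_density_const) auto
    finally show ?thesis .
  qed
  note coord = this
  have pre: "(\<lambda>x. \<lambda>i\<in>{..<n}. c * x i) -` PiE {..<n} A \<inter> space ?P = PiE {..<n} (\<lambda>i. (\<lambda>t. c * t) -` A i)"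
    by (auto simp: space_PiM PiE_iff)
  have sA: "(\<lambda>t. c * t) -` A i \<in> sets lborel" if "i < n" for i
  proof -
    have "(\<lambda>t. c * t) -` A i \<inter> space lborel \<in> sets lborel"
      by (rule measurable_sets[of _ _ lborel]) (use A that in auto)
    then show ?thesis by simp
  qed
  have "emeasure ?D (PiE {..<n} A) = (\<Prod>i<n. ennreal (inverse c) * emeasure lborel (A i))"
  proof -
    have "emeasure ?D (PiE {..<n} A) = emeasure ?P (PiE {..<n} (\<lambda>i. (\<lambda>t. c * t) -` A i))"
      using m s by (simp add: emeasure_distr pre)
    also have "\<dots> = (\<Prod>i<n. emeasure lborel ((\<lambda>t. c * t) -` A i))"
      using sA by (intro lborel_prod.emeasure_PiM) auto
    finally show ?thesis
      using coord by simp
  qed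
  then have "emeasure (density ?D (\<lambda>_. ennreal (c ^ n))) (PiE {..<n} A) =
     ennreal (c ^ n) * (ennreal (inverse c) ^ n * (\<Prod>i<n. emeasure lborel (A i)))"
    using s by (simp add: emeasure_density_const prod.distrib)
  also have "\<dots> = (\<Prod>i<n. emeasure lborel (A i))"
    using assms by (simp add: ennreal_power mult.assoc[symmetric] ennreal_mult[symmetric] power_mult_distrib[symmetric])
  finally show "emeasure (density ?D (\<lambda>_. ennreal (c ^ n))) (PiE {..<n} A) = (\<Prod>i<n. emeasure lborel (A i))" .
qed auto

text \<open>Carried over from the product measure, since padding a tuple with zeros commutes with
  scaling.\<close>

lemma vol_Rn_scale:
  assumes "0 < c"
  shows "density (distr (vol_Rn n) borel (vscale c)) (\<lambda>_. ennreal (c ^ n)) = vol_Rn n"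
proof -
  let ?P = "PiM {..<n} (\<lambda>_. lborel :: real measure)"
  let ?m = "\<lambda>x::nat\<Rightarrow>real. \<lambda>i\<in>{..<n}. c * x i"
  have m: "?m \<in> measurable ?P ?P"
    by (intro measurable_restrict) simp
  have "emeasure (density (distr (vol_Rn n) borel (vscale c)) (\<lambda>_. ennreal (c ^ n))) A = emeasure (vol_Rn n) A"
    if A[measurable]: "A \<in> sets borel" for A
  proof -
    have "emeasure (vol_Rn n) A = emeasure ?P (Rn_embed n -` A \<inter> space ?P)"
      by (simp add: vol_Rn_eq emeasure_distr A)
    also have "\<dots> = emeasure (density (distr ?P ?P ?m) (\<lambda>_. ennreal (c ^ n))) (Rn_embed n -` A \<inter> space ?P)"
      by (simp add: PiM_lborel_scale[OF assms])
    also have "\<dots> = ennreal (c ^ n) * emeasure ?P (?m -` (Rn_embed n -` A \<inter> space ?P) \<inter> space ?P)"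
      using m by (simp add: emeasure_density_const emeasure_distr)
    also have "?m -` (Rn_embed n -` A \<inter> space ?P) \<inter> space ?P
        = Rn_embed n -` (vscale c -` A) \<inter> space ?P"
    proof -
      have "Rn_embed n (?m x) = vscale c (Rn_embed n x)" for x
        by (auto simp: Rn_embed_def vscale_def)
      then show ?thesis
        using measurable_space[OF m] by auto
    qed
    also have "emeasure ?P \<dots> = emeasure (vol_Rn n) (vscale c -` A)"
      using measurable_sets_borel[OF measurable_vscale_const A]
      by (simp add: vol_Rn_eq emeasure_distr)
    also have "\<dots> = emeasure (distr (vol_Rn n) borel (vscale c)) A"
      by (subst emeasure_distr) (simp_all add: A)
    finally show ?thesis
      by (simp add: emeasure_density_const)
  qed
  note eq = this
  show ?thesis
  proof (rule measure_eqI)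
    show "sets (density (distr (vol_Rn n) borel (vscale c)) (\<lambda>_. ennreal (c ^ n))) = sets (vol_Rn n)"
      by simp
  qed (rule eq, simp)
qed

lemma integral_vol_Rn_scale:
  fixes g :: "(nat \<Rightarrow> real) \<Rightarrow> real"
  assumes "0 < c" and [measurable]: "g \<in> borel_measurable borel"
  shows "integral\<^sup>L (vol_Rn n) g = c ^ n * (LINT x|vol_Rn n. g (vscale c x))"
proof -
  have "integral\<^sup>L (vol_Rn n) g = integral\<^sup>L (density (distr (vol_Rn n) borel (vscale c)) (\<lambda>_. ennreal (c ^ n))) g"
    by (simp add: vol_Rn_scale[OF assms(1)])
  also have "\<dots> = (LINT x|distr (vol_Rn n) borel (vscale c). c ^ n *\<^sub>R g x)"
    by (subst integral_density) (simp_all add: assms(1) less_imp_le)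
  also have "\<dots> = c ^ n * (LINT x|vol_Rn n. g (vscale c x))"
    by (subst integral_distr) simp_all
  finally show ?thesis .
qed

lemma emeasure_vol_Rn_oball_finite: "emeasure (vol_Rn n) (oball n R) < \<infinity>"
proof -
  let ?P = "PiM {..<n} (\<lambda>_. lborel :: real measure)"
  have "emeasure (vol_Rn n) (oball n R) = emeasure ?P (Rn_embed n -` oball n R \<inter> space ?P)"
    by (simp add: vol_Rn_eq emeasure_distr)
  also have "\<dots> \<le> emeasure ?P (PiE {..<n} (\<lambda>_. {-\<bar>R\<bar>..\<bar>R\<bar>}))"
  proof (rule emeasure_mono)
    show "Rn_embed n -` oball n R \<inter> space ?P \<subseteq> PiE {..<n} (\<lambda>_. {-\<bar>R\<bar>..\<bar>R\<bar>})"
    proof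
      fix x assume "x \<in> Rn_embed n -` oball n R \<inter> space ?P"
      then have x: "vnorm n (Rn_embed n x) < R" "x \<in> extensional {..<n}"
        by (simp_all add: oball_def space_PiM PiE_iff)
      have "\<bar>x i\<bar> \<le> \<bar>R\<bar>" if "i < n" for i
        using component_le_vnorm[OF that, of "Rn_embed n x"] that x(1) by (simp add: Rn_embed_def)
      then show "x \<in> PiE {..<n} (\<lambda>_. {-\<bar>R\<bar>..\<bar>R\<bar>})"
        using x(2) by (simp add: PiE_iff abs_le_iff minus_le_iff)
    qed
    show "PiE {..<n} (\<lambda>_. {-\<bar>R\<bar>..\<bar>R\<bar>}) \<in> sets ?P"
      by (rule sets_PiM_I_finite) simp_all
  qed
  also have "\<dots> = ennreal ((2 * \<bar>R\<bar>) ^ n)"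
    by (subst lborel_prod.emeasure_PiM) (simp_all add: ennreal_power)
  finally show ?thesis
    by (rule le_less_trans) simp
qed

lemma emeasure_vol_Rn_unit_ball_pos: "0 < emeasure (vol_Rn n) (unit_ball n)"
proof -
  let ?P = "PiM {..<n} (\<lambda>_. lborel :: real measure)"
  \<comment> \<open>A cube of this side fits into the ball: the Euclidean norm is at most the sum of
    the coordinates, hence at most \<open>n / (n + 1)\<close>. The \<open>+ 1\<close> makes the
    inequality strict.\<close>
  define a where "a = 1 / (real n + 1)"
  have a: "0 < a" by (simp add: a_def)
  have "0 < ennreal (a ^ n)"
    using a by simp
  also have "ennreal (a ^ n) = emeasure ?P (PiE {..<n} (\<lambda>_. {0..a}))"
    using a by (subst lborel_prod.emeasure_PiM) (simp_all add: ennreal_power)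
  also have "\<dots> \<le> emeasure ?P (Rn_embed n -` unit_ball n \<inter> space ?P)"
  proof (rule emeasure_mono)
    show "PiE {..<n} (\<lambda>_. {0..a}) \<subseteq> Rn_embed n -` unit_ball n \<inter> space ?P"
    proof
      fix x assume x: "x \<in> PiE {..<n} (\<lambda>_. {0..a})"
      have "vnorm n (Rn_embed n x) \<le> (\<Sum>i<n. \<bar>Rn_embed n x i\<bar>)"
        unfolding vnorm_def by (rule L2_set_le_sum_abs)
      also have "\<dots> \<le> (\<Sum>i<n. a)"
        using x by (intro sum_mono) (auto simp: Rn_embed_def PiE_iff)
      also have "\<dots> < 1"
        by (simp add: a_def)
      finally show "x \<in> Rn_embed n -` unit_ball n \<inter> space ?P"
        using x by (auto simp: unit_ball_def topspace_Euclidean_space Rn_embed_def space_PiM PiE_iff)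
    qed
    show "Rn_embed n -` unit_ball n \<inter> space ?P \<in> sets ?P"
      unfolding unit_ball_eq_oball by (rule measurable_sets[OF measurable_Rn_embed borel_oball])
  qed
  also have "\<dots> = emeasure (vol_Rn n) (unit_ball n)"
    using borel_oball[of n 1] by (simp add: vol_Rn_eq emeasure_distr unit_ball_eq_oball)
  finally show ?thesis .
qed

text \<open>Fubini with the i-th coordinate integrated first. It will be applied to the i-th
  derivative of a function that vanishes at both ends of every chord in direction i.\<close>

lemma integral_vol_Rn_section_eq_0:
  fixes F :: "(nat \<Rightarrow> real) \<Rightarrow> real"
  assumes "i < n" and F: "integrable (vol_Rn n) F"
    and 0: "\<And>y. y \<in> Rn n \<Longrightarrow> (LINT t|lborel. F (y(i := t))) = 0"
  shows "integral\<^sup>L (vol_Rn n) F = 0"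
proof -
  let ?I = "{..<n} - {i}"
  let ?P = "\<lambda>I. PiM I (\<lambda>_. lborel :: real measure)"
  have I: "insert i ?I = {..<n}"
    using assms(1) by auto
  have [measurable]: "F \<in> borel_measurable borel"
    using borel_measurable_integrable[OF F] measurable_cong_sets[OF sets_vol_Rn refl] by blast
  have int: "integrable (?P {..<n}) (\<lambda>x. F (Rn_embed n x))"
    using F unfolding vol_Rn_eq by (rule integrable_distr[OF measurable_Rn_embed])
  have "integral\<^sup>L (vol_Rn n) F = (LINT x|?P {..<n}. F (Rn_embed n x))"
    unfolding vol_Rn_eq by (rule integral_distr) measurable
  also have "\<dots> = (LINT x|?P ?I. LINT t|lborel. F (Rn_embed n (x(i := t))))"
    using lborel_prod.product_integral_insert[of ?I i "\<lambda>x. F (Rn_embed n x)", unfolded I] int by simp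
  also have "\<dots> = 0"
  proof -
    have "Rn_embed n (x(i := t)) = (Rn_embed n x)(i := t)" for x t
      using assms(1) by (auto simp: Rn_embed_def)
    moreover have "Rn_embed n x \<in> Rn n" for x
      by (simp add: Rn_embed_def topspace_Euclidean_space)
    ultimately have "(LINT t|lborel. F (Rn_embed n (x(i := t)))) = 0" for x
      using 0 by simp
    then show ?thesis
      by simp
  qed
  finally show ?thesis .
qed

subsection \<open>Spherical means and ball integrals\<close>

definition ball_volume :: "nat \<Rightarrow> real" where
  "ball_volume n = measure (vol_Rn n) (unit_ball n)"

definition ball_integral :: "nat \<Rightarrow> ((nat \<Rightarrow> real) \<Rightarrow> real) \<Rightarrow> real \<Rightarrow> real" where
  "ball_integral n w R = (LINT x|vol_Rn n. indicator (oball n R) x * w x)"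

definition sphere_mean :: "nat \<Rightarrow> ((nat \<Rightarrow> real) \<Rightarrow> real) \<Rightarrow> real \<Rightarrow> real" where
  "sphere_mean n w s = (LINT z|sphere_measure n. w (vscale s z))"

definition radial_proj :: "nat \<Rightarrow> (nat \<Rightarrow> real) \<Rightarrow> (nat \<Rightarrow> real)" where
  "radial_proj n x = vscale (1 / vnorm n x) x"

lemma measurable_radial_proj [measurable]: "radial_proj n \<in> borel_measurable borel"
  unfolding radial_proj_def by (rule measurable_radial_projection)

lemma emeasure_unit_ball: "emeasure (vol_Rn n) (unit_ball n) = ennreal (ball_volume n)"
  using emeasure_vol_Rn_oball_finite[of n 1]
  by (simp add: ball_volume_def emeasure_eq_ennreal_measure unit_ball_eq_oball)

lemma ball_volume_pos: "0 < ball_volume n"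
  using emeasure_vol_Rn_unit_ball_pos[of n] by (simp add: emeasure_unit_ball)

lemma borel_unit_ball [measurable]: "unit_ball n \<in> sets borel"
  unfolding unit_ball_eq_oball by measurable

lemma radial_proj_vscale: "0 < c \<Longrightarrow> radial_proj n (vscale c x) = radial_proj n x"
  by (cases "vnorm n x = 0") (simp_all add: radial_proj_def vnorm_vscale)

lemma radial_proj_in_unit_sphere:
  assumes "x \<in> Rn n" "vnorm n x \<noteq> 0"
  shows "radial_proj n x \<in> unit_sphere n" "vscale (vnorm n x) (radial_proj n x) = x"
  using assms by (simp_all add: radial_proj_def unit_sphere_def vnorm_vscale vscale_in_Rn)

lemma uniform_measure_unit_ball_eq:
  "uniform_measure (vol_Rn n) (unit_ball n) =
     density (vol_Rn n) (\<lambda>x. ennreal (indicator (unit_ball n) x / ball_volume n))"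
proof -
  have "indicator (unit_ball n) x / ennreal (ball_volume n) = ennreal (indicator (unit_ball n) x / ball_volume n)" for x
    using ball_volume_pos[of n] divide_ennreal[of 1 "ball_volume n"]
    by (simp split: split_indicator)
  then show ?thesis
    by (simp add: uniform_measure_def emeasure_unit_ball)
qed

lemma sphere_measure_eq:
  "sphere_measure n = restrict_space
     (distr (uniform_measure (vol_Rn n) (unit_ball n)) borel (radial_proj n)) (unit_sphere n)"
  by (simp add: sphere_measure_def radial_proj_def[abs_def])

lemma space_sphere_measure [simp]: "space (sphere_measure n) = unit_sphere n"
  by (simp add: sphere_measure_eq space_restrict_space)

text \<open>The inner indicator carries the restriction to the sphere. It discards the origin, which
  \<open>radial_proj\<close> maps to itself.\<close>

lemma integral_sphere_measure:
  fixes h :: "(nat \<Rightarrow> real) \<Rightarrow> real"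
  assumes h [measurable]: "(\<lambda>z. indicator (unit_sphere n) z * h z) \<in> borel_measurable borel"
  shows "(LINT x|vol_Rn n. indicator (unit_ball n) x *
            (indicator (unit_sphere n) (radial_proj n x) * h (radial_proj n x)))
         = ball_volume n * integral\<^sup>L (sphere_measure n) h"
proof -
  let ?g = "\<lambda>z. indicator (unit_sphere n) z * h z"
  let ?U = "uniform_measure (vol_Rn n) (unit_ball n)"
  have "integral\<^sup>L (sphere_measure n) h = integral\<^sup>L (distr ?U borel (radial_proj n)) ?g"
    unfolding sphere_measure_eq by (subst integral_restrict_space) simp_all
  also have "\<dots> = integral\<^sup>L ?U (\<lambda>x. ?g (radial_proj n x))"
    by (rule integral_distr) simp_all
  also have "\<dots> = (LINT x|vol_Rn n. (indicator (unit_ball n) x / ball_volume n) *\<^sub>R ?g (radial_proj n x))"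
    unfolding uniform_measure_unit_ball_eq
  proof (rule integral_density)
    show "(\<lambda>x. ?g (radial_proj n x)) \<in> borel_measurable (vol_Rn n)"
      by measurable
    show "(\<lambda>x. indicator (unit_ball n) x / ball_volume n) \<in> borel_measurable (vol_Rn n)"
      by measurable
    show "AE x in vol_Rn n. 0 \<le> indicator (unit_ball n) x / ball_volume n"
      using ball_volume_pos[of n] by (simp add: less_imp_le)
  qed
  also have "\<dots> = (LINT x|vol_Rn n. (1 / ball_volume n) * (indicator (unit_ball n) x * ?g (radial_proj n x)))"
    by (rule Bochner_Integration.integral_cong) simp_all
  also have "\<dots> = (1 / ball_volume n) * (LINT x|vol_Rn n. indicator (unit_ball n) x * ?g (radial_proj n x))"
    by (rule integral_mult_right_zero)
  finally show ?thesis
    using ball_volume_pos[of n] by simp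
qed

lemma indicator_oball_vscale:
  "0 < R \<Longrightarrow> indicator (oball n R) (vscale R x) = (indicator (unit_ball n) x :: real)"
  by (simp add: oball_def unit_ball_def vnorm_vscale indicator_def)
     (simp add: topspace_Euclidean_space vscale_def)

text \<open>The integrand depends on the direction only and is invariant under dilations, so the
  scaling of volume produces \<open>R ^ n\<close>. This is integration in polar coordinates for
  functions homogeneous of degree 0.\<close>

lemma ball_integral_homogeneous:
  fixes h :: "(nat \<Rightarrow> real) \<Rightarrow> real"
  assumes h [measurable]: "(\<lambda>z. indicator (unit_sphere n) z * h z) \<in> borel_measurable borel"
    and R: "0 < R"
  shows "ball_integral n (\<lambda>x. indicator (unit_sphere n) (radial_proj n x) * h (radial_proj n x)) R
         = R ^ n * ball_volume n * integral\<^sup>L (sphere_measure n) h"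
proof -
  let ?g = "\<lambda>x. indicator (unit_sphere n) (radial_proj n x) * h (radial_proj n x)"
  have m: "(\<lambda>x. indicator (oball n R) x * ?g x) \<in> borel_measurable borel"
    by (rule borel_measurable_times[OF borel_measurable_indicator[OF borel_oball]
          measurable_compose[OF measurable_radial_proj h]])
  have "ball_integral n ?g R = R ^ n * (LINT x|vol_Rn n. indicator (unit_ball n) x * ?g x)"
    unfolding ball_integral_def integral_vol_Rn_scale[OF R m]
    by (simp add: radial_proj_vscale[OF R] indicator_oball_vscale[OF R])
  then show ?thesis
    by (simp add: integral_sphere_measure[OF h] mult.assoc)
qed

lemma measurable_on_unit_sphere:
  fixes h :: "(nat \<Rightarrow> real) \<Rightarrow> real"
  assumes "continuous_on (unit_sphere n) h"
  shows "(\<lambda>z. indicator (unit_sphere n) z * h z) \<in> borel_measurable borel"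
  using borel_measurable_continuous_on_indicator[OF borel_unit_sphere assms] by simp

text \<open>Dilation by 2 fixes the origin but multiplies volumes by \<open>2 ^ n\<close>, so the
  measure of the origin equals \<open>2 ^ n\<close> times itself.\<close>

lemma measure_vol_Rn_origin:
  assumes "0 < n"
  shows "measure (vol_Rn n) {\<lambda>_. 0} = 0"
proof -
  let ?g = "\<lambda>x::nat \<Rightarrow> real. indicator {\<lambda>_. 0} x :: real"
  have m: "?g \<in> borel_measurable borel"
    by (rule borel_measurable_indicator) simp
  have "vscale 2 x = (\<lambda>_. 0) \<longleftrightarrow> x = (\<lambda>_. 0)" for x :: "nat \<Rightarrow> real"
    unfolding vscale_def fun_eq_iff by simp
  then have "?g (vscale 2 x) = ?g x" for x
    by (simp add: indicator_def)
  then have "integral\<^sup>L (vol_Rn n) ?g = 2 ^ n * integral\<^sup>L (vol_Rn n) ?g"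
    using integral_vol_Rn_scale[of 2 ?g n] m by simp
  then have "integral\<^sup>L (vol_Rn n) ?g * (2 ^ n - 1) = 0"
    by (simp add: algebra_simps)
  moreover have "(2::real) ^ n > 1"
    using assms by (simp add: one_less_power)
  ultimately show ?thesis
    by simp
qed

text \<open>Total mass one: every point of the unit ball except the origin is projected into the
  sphere, and the origin is a null set.\<close>

lemma sphere_measure_const:
  assumes "0 < n"
  shows "(LINT z|sphere_measure n. c) = (c::real)"
proof -
  let ?o = "\<lambda>_::nat. 0 :: real"
  have o: "?o \<in> unit_ball n"
    by (simp add: unit_ball_def topspace_Euclidean_space)
  have eq: "indicator (unit_ball n) x * (indicator (unit_sphere n) (radial_proj n x) * c)
      = c * indicator (unit_ball n) x - c * indicator {?o} x" for x
  proof (cases "x \<in> unit_ball n")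
    case True
    then have x: "x \<in> Rn n"
      by (simp add: unit_ball_def)
    show ?thesis
    proof (cases "x = ?o")
      case True
      then have "radial_proj n x \<notin> unit_sphere n"
        by (simp add: radial_proj_def unit_sphere_def vnorm_vscale)
      then show ?thesis
        using True o by simp
    next
      case False
      then show ?thesis
        using radial_proj_in_unit_sphere(1)[OF x] x True by (simp add: vnorm_eq_0_iff)
    qed
  next
    case False
    then have "x \<noteq> ?o"
      using o by blast
    then show ?thesis
      using False by simp
  qed
  have fin: "emeasure (vol_Rn n) (unit_ball n) < \<infinity>"
    using emeasure_vol_Rn_oball_finite[of n 1] by (simp only: unit_ball_eq_oball)
  have "emeasure (vol_Rn n) {?o} \<le> emeasure (vol_Rn n) (unit_ball n)"
    using o by (intro emeasure_mono) simp_all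
  then have fin0: "emeasure (vol_Rn n) {?o} < \<infinity>"
    using fin by (rule le_less_trans)
  have "(\<lambda>z. indicator (unit_sphere n) z * c) \<in> borel_measurable borel"
    by (intro borel_measurable_times borel_measurable_indicator borel_unit_sphere borel_measurable_const)
  then have "ball_volume n * (LINT z|sphere_measure n. c)
     = (LINT x|vol_Rn n. c * indicator (unit_ball n) x - c * indicator {?o} x)"
    by (subst integral_sphere_measure[symmetric]) (simp_all only: eq)
  also have "\<dots> = (LINT x|vol_Rn n. c * indicator (unit_ball n) x) - (LINT x|vol_Rn n. c * indicator {?o} x)"
    by (intro Bochner_Integration.integral_diff integrable_mult_right integrable_real_indicator fin fin0) simp_all
  also have "\<dots> = c * ball_volume n"
    by (simp add: ball_volume_def measure_vol_Rn_origin[OF assms])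
  finally show ?thesis
    using ball_volume_pos[of n] by simp
qed

lemma finite_measure_sphere: "finite_measure (sphere_measure n)"
proof -
  have "emeasure (uniform_measure (vol_Rn n) (unit_ball n)) (space (uniform_measure (vol_Rn n) (unit_ball n))) \<noteq> \<infinity>"
    using ball_volume_pos[of n]
    by (subst emeasure_uniform_measure) (simp_all add: emeasure_unit_ball divide_ennreal)
  then interpret U: finite_measure "uniform_measure (vol_Rn n) (unit_ball n)"
    by (rule finite_measureI)
  have "finite_measure (distr (uniform_measure (vol_Rn n) (unit_ball n)) borel (radial_proj n))"
    by (rule U.finite_measure_distr) simp
  then show ?thesis
    unfolding sphere_measure_eq by (rule finite_measure_restrict_space) simp
qed

lemma integrable_sphere:
  fixes h :: "(nat \<Rightarrow> real) \<Rightarrow> real"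
  assumes "continuous_on (unit_sphere n) h"
  shows "integrable (sphere_measure n) h"
proof -
  have "bounded (h ` unit_sphere n)"
    using compact_continuous_image[OF assms compact_unit_sphere] by (rule compact_imp_bounded)
  then obtain K where "\<forall>y\<in>h ` unit_sphere n. norm y \<le> K"
    unfolding bounded_iff by blast
  then have "AE z in sphere_measure n. norm (h z) \<le> K"
    by (intro AE_I2) simp
  moreover have "h \<in> borel_measurable (sphere_measure n)"
    unfolding sphere_measure_eq
    using measurable_on_unit_sphere[OF assms] by (subst borel_measurable_restrict_space_iff) simp_all
  ultimately show ?thesis
    by (rule finite_measure.integrable_const_bound[OF finite_measure_sphere])
qed

lemma continuous_on_unit_sphere_vscale:
  fixes w :: "(nat \<Rightarrow> real) \<Rightarrow> real"
  assumes "continuous_on (unit_ball n) w" "s \<in> {0..<1}"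
  shows "continuous_on (unit_sphere n) (\<lambda>z. w (vscale s z))"
proof (rule continuous_on_compose2[OF assms(1)])
  show "continuous_on (unit_sphere n) (\<lambda>z. vscale s z)"
    by (intro continuous_on_vscale continuous_on_const continuous_on_id)
  show "vscale s ` unit_sphere n \<subseteq> unit_ball n"
    using vscale_unit_sphere_in_unit_ball assms(2) by blast
qed

lemma integrable_sphere_vscale:
  fixes w :: "(nat \<Rightarrow> real) \<Rightarrow> real"
  assumes "continuous_on (unit_ball n) w" "s \<in> {0..<1}"
  shows "integrable (sphere_measure n) (\<lambda>z. w (vscale s z))"
  by (rule integrable_sphere[OF continuous_on_unit_sphere_vscale[OF assms]])

lemma sphere_mean_mono:
  assumes "continuous_on (unit_ball n) v" "continuous_on (unit_ball n) w" "s \<in> {0..<1}"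
    and "\<And>x. x \<in> unit_ball n \<Longrightarrow> vnorm n x = s \<Longrightarrow> v x \<le> w x"
  shows "sphere_mean n v s \<le> sphere_mean n w s"
  unfolding sphere_mean_def
proof (rule integral_mono)
  fix z assume "z \<in> space (sphere_measure n)"
  then show "v (vscale s z) \<le> w (vscale s z)"
    using vscale_unit_sphere_in_unit_ball[of z n s] assms(3,4)
    by (simp add: vnorm_vscale unit_sphere_def)
qed (use assms in \<open>simp_all add: integrable_sphere_vscale\<close>)

lemma sphere_mean_cong:
  assumes "s \<in> {0..<1}"
    and "\<And>x. x \<in> unit_ball n \<Longrightarrow> vnorm n x = s \<Longrightarrow> v x = w x"
  shows "sphere_mean n v s = sphere_mean n w s"
  unfolding sphere_mean_def
proof (rule Bochner_Integration.integral_cong)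
  fix z assume "z \<in> space (sphere_measure n)"
  then show "v (vscale s z) = w (vscale s z)"
    using vscale_unit_sphere_in_unit_ball[of z n s] assms
    by (simp add: vnorm_vscale unit_sphere_def)
qed simp

lemma sphere_mean_add:
  assumes "continuous_on (unit_ball n) v" "continuous_on (unit_ball n) w" "s \<in> {0..<1}"
  shows "sphere_mean n (\<lambda>x. v x + w x) s = sphere_mean n v s + sphere_mean n w s"
  unfolding sphere_mean_def
  by (rule Bochner_Integration.integral_add) (use assms in \<open>simp_all add: integrable_sphere_vscale\<close>)

lemma sphere_mean_cmult: "sphere_mean n (\<lambda>x. c * w x) s = c * sphere_mean n w s"
  by (simp add: sphere_mean_def)

lemma sphere_mean_const: "0 < n \<Longrightarrow> sphere_mean n (\<lambda>x. c) s = c"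
  unfolding sphere_mean_def by (rule sphere_measure_const)

lemma sphere_mean_nonneg:
  assumes "s \<in> {0..<1}" "\<And>x. x \<in> unit_ball n \<Longrightarrow> 0 \<le> w x"
  shows "0 \<le> sphere_mean n w s"
  unfolding sphere_mean_def
  using assms vscale_unit_sphere_in_unit_ball by (intro integral_nonneg_AE AE_I2) simp

lemma sphere_mean_zero: "0 < n \<Longrightarrow> sphere_mean n w 0 = w (\<lambda>_. 0)"
  using sphere_mean_const[of n "w (\<lambda>_. 0)" 0] by (simp only: sphere_mean_def vscale_0)

lemma sphere_integral_dist_le:
  assumes "0 < n" "integrable (sphere_measure n) g" "integrable (sphere_measure n) h"
    and "\<And>z. z \<in> unit_sphere n \<Longrightarrow> \<bar>g z - h z\<bar> \<le> (e::real)"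
  shows "\<bar>integral\<^sup>L (sphere_measure n) g - integral\<^sup>L (sphere_measure n) h\<bar> \<le> e"
proof -
  have "\<bar>integral\<^sup>L (sphere_measure n) g - integral\<^sup>L (sphere_measure n) h\<bar>
      = \<bar>LINT z|sphere_measure n. g z - h z\<bar>"
    using assms by simp
  also have "\<dots> \<le> (LINT z|sphere_measure n. \<bar>g z - h z\<bar>)"
    by (rule integral_abs_bound)
  also have "\<dots> \<le> (LINT z|sphere_measure n. e)"
    using assms(2-4) finite_measure.integrable_const[OF finite_measure_sphere[of n], of e]
    by (intro integral_mono) auto
  also have "\<dots> = e"
    by (rule sphere_measure_const[OF assms(1)])
  finally show ?thesis .
qed

lemma continuous_on_sphere_mean:
  assumes "0 < n" "continuous_on (unit_ball n) w"
  shows "continuous_on {0..<1} (sphere_mean n w)"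
  unfolding continuous_on_iff
proof (intro ballI allI impI)
  fix s e :: real assume s: "s \<in> {0..<1}" and e: "0 < e"
  define R where "R = (1 + s) / 2"
  have R: "s < R" "R < 1"
    using s by (simp_all add: R_def)
  have "0 < e / 2"
    using e by simp
  from uniformly_continuous_radially[OF assms(2) R(2) this] obtain d where d: "0 < d"
    "\<And>s s' z. s \<in> {0..R} \<Longrightarrow> s' \<in> {0..R} \<Longrightarrow> \<bar>s - s'\<bar> < d \<Longrightarrow> z \<in> unit_sphere n
       \<Longrightarrow> \<bar>w (vscale s z) - w (vscale s' z)\<bar> < e / 2"
    by blast
  show "\<exists>d>0. \<forall>x'\<in>{0..<1}. dist x' s < d \<longrightarrow> dist (sphere_mean n w x') (sphere_mean n w s) < e"
  proof (intro exI[of _ "min d (R - s)"] conjI ballI impI)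
    show "0 < min d (R - s)"
      using d(1) R by simp
    fix s' assume s': "s' \<in> {0..<1}" "dist s' s < min d (R - s)"
    have "\<bar>sphere_mean n w s' - sphere_mean n w s\<bar> \<le> e / 2"
      unfolding sphere_mean_def
    proof (rule sphere_integral_dist_le)
      fix z assume "z \<in> unit_sphere n"
      then show "\<bar>w (vscale s' z) - w (vscale s z)\<bar> \<le> e / 2"
        using s s' R by (intro less_imp_le d(2)) (auto simp: dist_real_def)
    qed (use assms s s' in \<open>simp_all add: integrable_sphere_vscale\<close>)
    then show "dist (sphere_mean n w s') (sphere_mean n w s) < e"
      using e by (simp add: dist_real_def)
  qed
qed

section \<open>Ball integrals and their dependence on the radius\<close>

lemma integrable_on_oball:
  fixes w :: "(nat \<Rightarrow> real) \<Rightarrow> real"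
  assumes "continuous_on (unit_ball n) w" "R < 1"
  shows "integrable (vol_Rn n) (\<lambda>x. indicator (oball n R) x * w x)"
proof -
  obtain K where K: "0 \<le> K" "\<And>x. x \<in> kball n R \<Longrightarrow> \<bar>w x\<bar> \<le> K"
    using continuous_on_kball_bounded[OF assms] by blast
  have "continuous_on (oball n R) w"
    using assms oball_subset_unit_ball[of R n] by (blast intro: continuous_on_subset less_imp_le)
  then have "(\<lambda>x. indicator (oball n R) x *\<^sub>R w x) \<in> borel_measurable borel"
    by (rule borel_measurable_continuous_on_indicator[OF borel_oball])
  then have m: "(\<lambda>x. indicator (oball n R) x * w x) \<in> borel_measurable borel"
    by (simp only: real_scaleR_def)
  have "integrable (vol_Rn n) (\<lambda>x. K * indicator (oball n R) x)"
    using emeasure_vol_Rn_oball_finite[of n R]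
    by (intro integrable_mult_right integrable_real_indicator) simp_all
  then show ?thesis
  proof (rule Bochner_Integration.integrable_bound)
    show "(\<lambda>x. indicator (oball n R) x * w x) \<in> borel_measurable (vol_Rn n)"
      using m measurable_cong_sets[OF sets_vol_Rn refl] by blast
    show "AE x in vol_Rn n. norm (indicator (oball n R) x * w x) \<le> norm (K * indicator (oball n R) x)"
      using K oball_subset_kball[of n R] by (intro AE_I2) (auto split: split_indicator)
  qed
qed

lemma ball_integral_nonneg:
  assumes "R \<le> 1" "\<And>x. x \<in> unit_ball n \<Longrightarrow> 0 \<le> w x"
  shows "0 \<le> ball_integral n w R"
  unfolding ball_integral_def
  using assms oball_subset_unit_ball[of R n]
  by (intro integral_nonneg_AE AE_I2) (auto split: split_indicator)

lemma ball_integral_const: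
  assumes "0 < n" "0 < R" "R < 1"
  shows "ball_integral n (\<lambda>_. c) R = c * R ^ n * ball_volume n"
proof -
  have m: "(\<lambda>x. indicator (oball n R) x * c) \<in> borel_measurable borel"
    by (intro borel_measurable_times borel_measurable_indicator borel_oball) simp_all
  then show ?thesis
    unfolding ball_integral_def integral_vol_Rn_scale[OF assms(2) m]
    by (simp add: indicator_oball_vscale assms ball_volume_def)
qed

lemma ball_integral_bound:
  assumes "0 < n" "continuous_on (unit_ball n) w" "0 < R" "R \<le> R1" "R1 < 1"
    and "\<And>x. x \<in> kball n R1 \<Longrightarrow> \<bar>w x\<bar> \<le> K"
  shows "\<bar>ball_integral n w R\<bar> \<le> K * R ^ n * ball_volume n"
proof -
  have "\<bar>ball_integral n w R\<bar> \<le> (LINT x|vol_Rn n. \<bar>indicator (oball n R) x * w x\<bar>)"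
    unfolding ball_integral_def by (rule integral_abs_bound)
  also have "\<dots> \<le> (LINT x|vol_Rn n. indicator (oball n R) x * K)"
  proof (rule integral_mono)
    show "integrable (vol_Rn n) (\<lambda>x. \<bar>indicator (oball n R) x * w x\<bar>)"
      using assms by (intro integrable_abs integrable_on_oball) simp_all
    show "integrable (vol_Rn n) (\<lambda>x. indicator (oball n R) x * K)"
      using assms by (intro integrable_on_oball) simp_all
    show "\<bar>indicator (oball n R) x * w x\<bar> \<le> indicator (oball n R) x * K" for x
      using assms(4,6) by (auto simp: oball_def kball_def split: split_indicator)
  qed
  also have "\<dots> = K * R ^ n * ball_volume n"
    using ball_integral_const[of n R K] assms by (simp add: ball_integral_def)
  finally show ?thesis .
qed

text \<open>On the shell between the radii r and r', w is compared with the function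
  \<open>g\<close> that takes in each direction the value of w at radius b. Uniform continuity keeps
  the two within e, and the integral of \<open>g\<close> is known by homogeneity. As b may be either
  end of the shell, the estimate serves difference quotients from both sides.\<close>

lemma ball_integral_shell_estimate:
  assumes n: "0 < n" and w: "continuous_on (unit_ball n) w" and r: "0 < r" "r \<le> r'" "r' \<le> R1" "R1 < 1"
    and b: "b \<in> {r..r'}"
    and d: "\<And>s s' z. s \<in> {0..R1} \<Longrightarrow> s' \<in> {0..R1} \<Longrightarrow> \<bar>s - s'\<bar> < d \<Longrightarrow> z \<in> unit_sphere n
       \<Longrightarrow> \<bar>w (vscale s z) - w (vscale s' z)\<bar> < e"
    and "r' - r < d"
  shows "\<bar>ball_integral n w r' - ball_integral n w r - ball_volume n * (r' ^ n - r ^ n) * sphere_mean n w b\<bar>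
         \<le> e * (ball_volume n * (r' ^ n - r ^ n))"
proof -
  define g where "g = (\<lambda>x. indicator (unit_sphere n) (radial_proj n x) * w (vscale b (radial_proj n x)))"
  define S where "S = (\<lambda>x. indicator (oball n r') x - indicator (oball n r) x :: real)"
  have b1: "b \<in> {0..<1}"
    using b r by auto
  have m: "(\<lambda>z. indicator (unit_sphere n) z * w (vscale b z)) \<in> borel_measurable borel"
    by (rule measurable_on_unit_sphere[OF continuous_on_unit_sphere_vscale[OF w b1]])
  have gint: "ball_integral n g \<rho> = \<rho> ^ n * ball_volume n * sphere_mean n w b" if "0 < \<rho>" for \<rho>
    unfolding g_def sphere_mean_def by (rule ball_integral_homogeneous[OF m that])
  have "bounded ((\<lambda>z. w (vscale b z)) ` unit_sphere n)"
    using compact_continuous_image[OF continuous_on_unit_sphere_vscale[OF w b1] compact_unit_sphere]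
    by (rule compact_imp_bounded)
  then obtain K where "\<forall>y\<in>(\<lambda>z. w (vscale b z)) ` unit_sphere n. norm y \<le> K"
    unfolding bounded_iff by blast
  then have gK: "\<bar>g x\<bar> \<le> \<bar>K\<bar>" for x
    by (auto simp: g_def split: split_indicator)
  have gm: "g \<in> borel_measurable borel"
    unfolding g_def using measurable_compose[OF measurable_radial_proj m] by simp
  have gi: "integrable (vol_Rn n) (\<lambda>x. indicator (oball n \<rho>) x * g x)" if "\<rho> < 1" for \<rho>
  proof (rule Bochner_Integration.integrable_bound)
    show "integrable (vol_Rn n) (\<lambda>x. indicator (oball n \<rho>) x * K)"
      using that by (intro integrable_on_oball) simp_all
    have "(\<lambda>x. indicator (oball n \<rho>) x * g x) \<in> borel_measurable borel"
      by (intro borel_measurable_times borel_measurable_indicator borel_oball gm)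
    then show "(\<lambda>x. indicator (oball n \<rho>) x * g x) \<in> borel_measurable (vol_Rn n)"
      using measurable_cong_sets[OF sets_vol_Rn refl] by blast
    show "AE x in vol_Rn n. norm (indicator (oball n \<rho>) x * g x) \<le> norm (indicator (oball n \<rho>) x * K)"
      using gK by (intro AE_I2) (auto split: split_indicator)
  qed
  have r1: "r < 1" "r' < 1" "0 < r'"
    using r by auto
  have wi: "integrable (vol_Rn n) (\<lambda>x. indicator (oball n \<rho>) x * w x)" if "\<rho> < 1" for \<rho>
    by (rule integrable_on_oball[OF w that])
  have ci: "integrable (vol_Rn n) (\<lambda>x. indicator (oball n \<rho>) x * e)" if "\<rho> < 1" for \<rho>
    using that by (intro integrable_on_oball) simp_all
  have "ball_integral n w r' - ball_integral n w r - (ball_integral n g r' - ball_integral n g r)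
      = (LINT x|vol_Rn n. S x * (w x - g x))"
    unfolding ball_integral_def S_def using wi gi r1
    by (simp add: algebra_simps)
  also have "\<bar>\<dots>\<bar> \<le> (LINT x|vol_Rn n. \<bar>S x * (w x - g x)\<bar>)"
    by (rule integral_abs_bound)
  also have "\<dots> \<le> (LINT x|vol_Rn n. S x * e)"
  proof (rule integral_mono)
    show "integrable (vol_Rn n) (\<lambda>x. \<bar>S x * (w x - g x)\<bar>)"
      unfolding S_def using wi gi r1 by (intro integrable_abs) (simp add: algebra_simps)
    show "integrable (vol_Rn n) (\<lambda>x. S x * e)"
      unfolding S_def using ci r1 by (simp add: algebra_simps)
    show "\<bar>S x * (w x - g x)\<bar> \<le> S x * e" for x
    proof (cases "x \<in> oball n r' \<and> x \<notin> oball n r")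
      case True
      then have x: "x \<in> Rn n" "r \<le> vnorm n x" "vnorm n x < r'"
        by (auto simp: oball_def)
      note p = radial_proj_in_unit_sphere[of x n]
      have "\<bar>w (vscale (vnorm n x) (radial_proj n x)) - w (vscale b (radial_proj n x))\<bar> < e"
        using x r b \<open>r' - r < d\<close> p by (intro d) auto
      then show ?thesis
        using True x r p by (simp add: S_def g_def)
    next
      case False
      moreover have "x \<in> oball n r \<Longrightarrow> x \<in> oball n r'"
        using r by (auto simp: oball_def)
      ultimately have "S x = 0"
        by (auto simp: S_def split: split_indicator)
      then show ?thesis
        by simp
    qed
  qed
  also have "\<dots> = ball_integral n (\<lambda>_. e) r' - ball_integral n (\<lambda>_. e) r"
    unfolding S_def ball_integral_def using ci r1 by (simp add: algebra_simps)
  finally show ?thesis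
    using r r1 n by (simp add: gint ball_integral_const algebra_simps)
qed

text \<open>Integration in polar coordinates, in differential form. The increment is first divided
  by the volume increment \<open>ball_volume n * (y ^ n - R ^ n)\<close>, where the shell estimate
  gives the limit directly; the quotient of \<open>y ^ n\<close> then supplies the factor
  \<open>n * R ^ (n - 1)\<close>.\<close>

lemma ball_integral_has_derivative:
  assumes n: "0 < n" and w: "continuous_on (unit_ball n) w" and R: "0 < R" "R < 1"
  shows "(ball_integral n w has_real_derivative n * R ^ (n - 1) * (ball_volume n * sphere_mean n w R)) (at R)"
proof -
  define R1 where "R1 = (1 + R) / 2"
  have R1: "R < R1" "R1 < 1"
    using R by (simp_all add: R1_def)
  define q where "q = (\<lambda>y. (ball_integral n w y - ball_integral n w R) / (ball_volume n * (y ^ n - R ^ n)))"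
  have ne: "y ^ n - R ^ n \<noteq> 0" if "0 < y" "y \<noteq> R" for y
    using that R n by (simp add: power_eq_iff_eq_base)
  have q: "q \<midarrow>R\<rightarrow> sphere_mean n w R"
  proof (rule LIM_I)
    fix e :: real assume e: "0 < e"
    then have "0 < e / 2" by simp
    from uniformly_continuous_radially[OF w R1(2) this] obtain d where d: "0 < d"
      "\<And>s s' z. s \<in> {0..R1} \<Longrightarrow> s' \<in> {0..R1} \<Longrightarrow> \<bar>s - s'\<bar> < d \<Longrightarrow> z \<in> unit_sphere n
         \<Longrightarrow> \<bar>w (vscale s z) - w (vscale s' z)\<bar> < e / 2"
      by blast
    show "\<exists>s>0. \<forall>x. x \<noteq> R \<and> norm (x - R) < s \<longrightarrow> norm (q x - sphere_mean n w R) < e"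
    proof (intro exI[of _ "min d (min R (R1 - R))"] conjI allI impI)
      show "0 < min d (min R (R1 - R))"
        using d R R1 by simp
      fix y assume "y \<noteq> R \<and> norm (y - R) < min d (min R (R1 - R))"
      then have y: "y \<noteq> R" "\<bar>y - R\<bar> < d" "0 < y" "y < R1"
        by auto
      define k where "k = ball_volume n * (y ^ n - R ^ n)"
      have k: "k \<noteq> 0"
        using ne[OF y(3,1)] ball_volume_pos[of n] by (simp add: k_def)
      have "\<bar>ball_integral n w y - ball_integral n w R - k * sphere_mean n w R\<bar> \<le> e / 2 * \<bar>k\<bar>"
      \<comment> \<open>The mean is taken at R in both cases: R is the outer radius of the shell if
        y is smaller, and the inner radius otherwise.\<close>
      proof (cases "y < R")
        case True
        have "y ^ n \<le> R ^ n"
          using True y by (intro power_mono) auto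
        then have "\<bar>k\<bar> = ball_volume n * (R ^ n - y ^ n)"
          using ball_volume_pos[of n] by (simp add: k_def abs_mult)
        moreover have "\<bar>ball_integral n w R - ball_integral n w y - ball_volume n * (R ^ n - y ^ n) * sphere_mean n w R\<bar>
         \<le> e / 2 * (ball_volume n * (R ^ n - y ^ n))"
          by (rule ball_integral_shell_estimate[OF n w _ _ _ R1(2) _ d(2)]) (use True y R R1 in auto)
        moreover have "\<bar>ball_integral n w R - ball_integral n w y - ball_volume n * (R ^ n - y ^ n) * sphere_mean n w R\<bar>
          = \<bar>ball_integral n w y - ball_integral n w R - k * sphere_mean n w R\<bar>"
          by (subst abs_minus_commute) (simp add: k_def algebra_simps)
        ultimately show ?thesis
          by simp
      next
        case False
        have "R ^ n \<le> y ^ n"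
          using False R by (intro power_mono) auto
        then have "\<bar>k\<bar> = ball_volume n * (y ^ n - R ^ n)"
          using ball_volume_pos[of n] by (simp add: k_def abs_mult)
        moreover have "\<bar>ball_integral n w y - ball_integral n w R - ball_volume n * (y ^ n - R ^ n) * sphere_mean n w R\<bar>
         \<le> e / 2 * (ball_volume n * (y ^ n - R ^ n))"
          by (rule ball_integral_shell_estimate[OF n w _ _ _ R1(2) _ d(2)]) (use False y R R1 in auto)
        ultimately show ?thesis
          by (simp add: k_def)
      qed
      then have "\<bar>ball_integral n w y - ball_integral n w R - k * sphere_mean n w R\<bar> / \<bar>k\<bar> \<le> e / 2"
        using k by (simp add: pos_divide_le_eq)
      then have "\<bar>(ball_integral n w y - ball_integral n w R - k * sphere_mean n w R) / k\<bar> \<le> e / 2"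
        by simp
      moreover have "(ball_integral n w y - ball_integral n w R - k * sphere_mean n w R) / k = q y - sphere_mean n w R"
        using k by (simp add: q_def k_def diff_divide_distrib)
      ultimately show "norm (q y - sphere_mean n w R) < e"
        using e by simp
    qed
  qed
  have "((\<lambda>y. y ^ n) has_real_derivative n * R ^ (n - 1)) (at R)"
    by (auto intro!: derivative_eq_intros)
  then have "(\<lambda>y. (y ^ n - R ^ n) / (y - R)) \<midarrow>R\<rightarrow> n * R ^ (n - 1)"
    by (simp add: has_field_derivative_iff)
  then have lim: "(\<lambda>y. (y ^ n - R ^ n) / (y - R) * (ball_volume n * q y)) \<midarrow>R\<rightarrow>
       n * R ^ (n - 1) * (ball_volume n * sphere_mean n w R)"
    by (intro tendsto_intros q)
  \<comment> \<open>For even n also \<open>y = - R\<close> satisfies \<open>y ^ n = R ^ n\<close>;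
    near R all y are positive and the denominator of \<open>q\<close> vanishes only at R.\<close>
  have "eventually (\<lambda>y. y \<in> {0<..}) (nhds R)"
    by (rule eventually_nhds_in_open) (use R in auto)
  then have "eventually (\<lambda>y. (y ^ n - R ^ n) / (y - R) * (ball_volume n * q y)
      = (ball_integral n w y - ball_integral n w R) / (y - R)) (at R)"
    unfolding eventually_at_filter
  proof eventually_elim
    case (elim y)
    then show ?case
      using ne[of y] ball_volume_pos[of n] by (auto simp: q_def)
  qed
  with lim show ?thesis
    unfolding has_field_derivative_iff by (blast intro: Lim_transform_eventually)
qed

subsection \<open>The divergence theorem on balls\<close>

lemma continuous_on_fun_upd:
  fixes g :: "'a::topological_space \<Rightarrow> real" and y :: "nat \<Rightarrow> real"
  assumes "continuous_on A g"
  shows "continuous_on A (\<lambda>t. y(i := g t))"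
proof (rule continuous_on_coordinatewise_then_product)
  show "continuous_on A (\<lambda>t. (y(i := g t)) j)" for j
    by (cases "j = i") (simp_all add: assms)
qed

lemma continuous_on_coordinate [continuous_intros]:
  "continuous_on A (\<lambda>x::nat \<Rightarrow> real. x i)"
  by (rule continuous_on_subset[OF continuous_on_product_coordinates subset_UNIV])

lemma vnorm_square_upd:
  assumes "i < n"
  shows "(vnorm n (y(i := t)))\<^sup>2 = (\<Sum>j\<in>{..<n}-{i}. (y j)\<^sup>2) + t\<^sup>2"
proof -
  have "(vnorm n (y(i := t)))\<^sup>2 = ((y(i := t)) i)\<^sup>2 + (\<Sum>j\<in>{..<n}-{i}. ((y(i := t)) j)\<^sup>2)"
    unfolding vnorm_square using assms by (intro sum.remove) auto
  also have "(\<Sum>j\<in>{..<n}-{i}. ((y(i := t)) j)\<^sup>2) = (\<Sum>j\<in>{..<n}-{i}. (y j)\<^sup>2)"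
    by (rule sum.cong) auto
  finally show ?thesis
    by (simp only: fun_upd_same add.commute)
qed

text \<open>The factor \<open>r\<^sup>2 - \<bar>x\<bar>\<^sup>2\<close> vanishes on the boundary, so no surface term appears.\<close>

lemma integral_partial_cutoff_eq_0:
  assumes i: "i < n" and r: "0 < r" "r < 1"
    and V: "continuous_on (unit_ball n) V" and D: "continuous_on (unit_ball n) D"
    and VD: "\<And>x. x \<in> unit_ball n \<Longrightarrow> ((\<lambda>t. V (x(i := t))) has_real_derivative D x) (at (x i))"
  shows "ball_integral n (\<lambda>x. (r\<^sup>2 - (vnorm n x)\<^sup>2) * D x - 2 * x i * V x) r = 0"
  unfolding ball_integral_def
proof (rule integral_vol_Rn_section_eq_0[OF i])
  have "continuous_on (unit_ball n) (\<lambda>x. (r\<^sup>2 - (vnorm n x)\<^sup>2) * D x - 2 * x i * V x)"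
    by (intro continuous_intros V D)
  then show "integrable (vol_Rn n) (\<lambda>x. indicator (oball n r) x * ((r\<^sup>2 - (vnorm n x)\<^sup>2) * D x - 2 * x i * V x))"
    using r by (intro integrable_on_oball)
  fix y assume y: "y \<in> Rn n"
  define A where "A = (\<Sum>j\<in>{..<n}-{i}. (y j)\<^sup>2)"
  have nA: "(vnorm n (y(i := t)))\<^sup>2 = A + t\<^sup>2" for t
    unfolding A_def by (rule vnorm_square_upd[OF i])
  have yR: "y(i := t) \<in> Rn n" for t
    using y i by (auto simp: topspace_Euclidean_space)
  have lt: "vnorm n (y(i := t)) < r \<longleftrightarrow> A + t\<^sup>2 < r\<^sup>2" for t
    unfolding nA[symmetric] using r power_mono_iff[of r "vnorm n (y(i := t))" 2] by (simp add: not_le[symmetric])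
  have le: "vnorm n (y(i := t)) \<le> r \<longleftrightarrow> A + t\<^sup>2 \<le> r\<^sup>2" for t
    unfolding nA[symmetric] using r power_mono_iff[of "vnorm n (y(i := t))" r 2] by simp
  define g where "g = (\<lambda>t. (r\<^sup>2 - (A + t\<^sup>2)) * D (y(i := t)) - 2 * t * V (y(i := t)))"
  have F: "indicator (oball n r) (y(i := t)) * ((r\<^sup>2 - (vnorm n (y(i := t)))\<^sup>2) * D (y(i := t)) - 2 * (y(i := t)) i * V (y(i := t)))
     = (if A + t\<^sup>2 < r\<^sup>2 then g t else 0)" for t
    using yR lt[of t] by (simp add: oball_def nA g_def)
  show "(LINT t|lborel. indicator (oball n r) (y(i := t)) * ((r\<^sup>2 - (vnorm n (y(i := t)))\<^sup>2) * D (y(i := t)) - 2 * (y(i := t)) i * V (y(i := t)))) = 0"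
    unfolding F
  proof (cases "A < r\<^sup>2")
    case False
    then have "\<not> A + t\<^sup>2 < r\<^sup>2" for t
      using zero_le_power2[of t] by linarith
    then show "(LINT t|lborel. (if A + t\<^sup>2 < r\<^sup>2 then g t else 0)) = 0"
      by simp
  next
    case True
    \<comment> \<open>Half the length of the chord that the line through y in direction i cuts out
      of the ball.\<close>
    define a where "a = sqrt (r\<^sup>2 - A)"
    have a: "0 < a" "a\<^sup>2 = r\<^sup>2 - A"
      using True by (simp_all add: a_def)
    \<comment> \<open>Because r is less than 1, the closed chord still lies in the open unit ball,
      and the derivative exists at its end points as well.\<close>
    have in_ball: "y(i := t) \<in> unit_ball n" if "t \<in> {-a..a}" for t
    proof -
      have "t\<^sup>2 \<le> a\<^sup>2"
        using that a(1) by (simp add: abs_le_square_iff[symmetric] abs_le_iff)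
      then have "vnorm n (y(i := t)) \<le> r"
        unfolding le using a by simp
      then show ?thesis
        using yR r by (simp add: unit_ball_def)
    qed
    define G where "G = (\<lambda>t. (r\<^sup>2 - (A + t\<^sup>2)) * V (y(i := t)))"
    have "has_bochner_integral lborel (\<lambda>t. indicator {-a..a} t *\<^sub>R g t) (G a - G (-a))"
    proof (rule has_bochner_integral_FTC_Icc)
      show "-a \<le> a" using a by simp
      show "(G has_vector_derivative g t) (at t within {-a..a})" if "-a \<le> t" "t \<le> a" for t
      proof -
        have "((\<lambda>s. V (y(i := s))) has_real_derivative D (y(i := t))) (at t)"
          using VD[OF in_ball, of t] that by simp
        then have "(G has_real_derivative g t) (at t)"
          unfolding G_def g_def by (auto intro!: derivative_eq_intros)
        then show ?thesis
          by (simp add: has_real_derivative_iff_has_vector_derivative has_vector_derivative_at_within)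
      qed
      have im: "(\<lambda>t. y(i := t)) ` {-a..a} \<subseteq> unit_ball n"
        using in_ball by blast
      have "continuous_on {-a..a} (\<lambda>t. D (y(i := t)))" "continuous_on {-a..a} (\<lambda>t. V (y(i := t)))"
        by (rule continuous_on_compose2[OF D continuous_on_fun_upd[OF continuous_on_id] im]
                 continuous_on_compose2[OF V continuous_on_fun_upd[OF continuous_on_id] im])+
      then show "continuous_on {-a..a} g"
        unfolding g_def by (intro continuous_intros)
    qed
    moreover have "G a = 0" "G (-a) = 0"
      using a(2) by (simp_all add: G_def)
    ultimately have "(LINT t|lborel. indicator {-a..a} t *\<^sub>R g t) = 0"
      by (simp add: has_bochner_integral_iff)
    moreover have "(LINT t|lborel. (if A + t\<^sup>2 < r\<^sup>2 then g t else 0)) = (LINT t|lborel. indicator {-a<..<a} t *\<^sub>R g t)"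
    proof (rule Bochner_Integration.integral_cong)
      fix t
      have "A + t\<^sup>2 < r\<^sup>2 \<longleftrightarrow> t\<^sup>2 < a\<^sup>2"
        using a by linarith
      also have "\<dots> \<longleftrightarrow> t \<in> {-a<..<a}"
        unfolding not_le[symmetric, of "t\<^sup>2"] abs_le_square_iff[symmetric] using a(1) by auto
      finally show "(if A + t\<^sup>2 < r\<^sup>2 then g t else 0) = indicator {-a<..<a} t *\<^sub>R g t"
        by simp
    qed simp
    \<comment> \<open>The open ball gives the open chord, the fundamental theorem the closed one;
      they differ by two points.\<close>
    moreover have "(LINT t|lborel. indicator {-a<..<a} t *\<^sub>R g t) = (LINT t|lborel. indicator {-a..a} t *\<^sub>R g t)"
    proof (rule integral_discrete_difference)
      show "countable {-a, a}" by simp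
      show "indicator {-a<..<a} t *\<^sub>R g t = indicator {-a..a} t *\<^sub>R g t" if "t \<notin> {-a, a}" for t
        using that by (auto split: split_indicator)
    qed auto
    ultimately show "(LINT t|lborel. (if A + t\<^sup>2 < r\<^sup>2 then g t else 0)) = 0"
      by simp
  qed
qed

lemma ball_integral_sum:
  assumes "\<And>i. i \<in> I \<Longrightarrow> continuous_on (unit_ball n) (w i)" "R < 1"
  shows "ball_integral n (\<lambda>x. \<Sum>i\<in>I. w i x) R = (\<Sum>i\<in>I. ball_integral n (w i) R)"
  unfolding ball_integral_def sum_distrib_left
  by (rule Bochner_Integration.integral_sum) (simp add: integrable_on_oball assms)

lemma ball_integral_diff:
  assumes "continuous_on (unit_ball n) v" "continuous_on (unit_ball n) w" "R < 1"
  shows "ball_integral n (\<lambda>x. v x - w x) R = ball_integral n v R - ball_integral n w R"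
  unfolding ball_integral_def right_diff_distrib
  by (rule Bochner_Integration.integral_diff) (simp_all add: integrable_on_oball assms)

lemma ball_integral_cmult: "ball_integral n (\<lambda>x. c * w x) R = c * ball_integral n w R"
  by (simp add: ball_integral_def mult.left_commute)

text \<open>Differentiating \<open>\<integral>(R\<^sup>2 - \<bar>x\<bar>\<^sup>2) div V = 2 \<integral> V \<cdot> x\<close> over the ball of radius \<open>R\<close> in \<open>R\<close>
  gives the boundary form.\<close>

theorem divergence_ball:
  assumes n: "0 < n" and R: "0 < R" "R < 1"
    and V: "\<And>i. i < n \<Longrightarrow> continuous_on (unit_ball n) (V i)"
    and D: "\<And>i. i < n \<Longrightarrow> continuous_on (unit_ball n) (D i)"
    and VD: "\<And>i x. i < n \<Longrightarrow> x \<in> unit_ball n \<Longrightarrow>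
               ((\<lambda>t. V i (x(i := t))) has_real_derivative D i x) (at (x i))"
  shows "R * ball_integral n (\<lambda>x. \<Sum>i<n. D i x) R
         = n * R ^ (n - 1) * (ball_volume n * sphere_mean n (\<lambda>x. \<Sum>i<n. V i x * x i) R)"
proof -
  define v where "v = (\<lambda>x. \<Sum>i<n. D i x)"
  define u where "u = (\<lambda>x. (vnorm n x)\<^sup>2 * v x)"
  define b where "b = (\<lambda>x. \<Sum>i<n. V i x * x i)"
  have cv: "continuous_on (unit_ball n) v"
    unfolding v_def by (intro continuous_on_sum D) simp
  have cu: "continuous_on (unit_ball n) u"
    unfolding u_def by (intro continuous_intros cv)
  have cb: "continuous_on (unit_ball n) b"
    unfolding b_def by (intro continuous_intros V) simp
  have eq: "r\<^sup>2 * ball_integral n v r - ball_integral n u r - 2 * ball_integral n b r = 0"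
    if r: "0 < r" "r < 1" for r
  proof -
    have "r\<^sup>2 * ball_integral n v r - ball_integral n u r - 2 * ball_integral n b r
       = ball_integral n (\<lambda>x. r\<^sup>2 * v x - u x - 2 * b x) r"
      using r by (simp add: ball_integral_diff ball_integral_cmult cv cu cb continuous_on_mult continuous_on_diff)
    also have "(\<lambda>x. r\<^sup>2 * v x - u x - 2 * b x) = (\<lambda>x. \<Sum>i<n. (r\<^sup>2 - (vnorm n x)\<^sup>2) * D i x - 2 * x i * V i x)"
      by (simp add: fun_eq_iff u_def v_def b_def sum_subtractf sum_distrib_left[symmetric] left_diff_distrib)
         (simp add: sum_distrib_left mult_ac)
    also have "ball_integral n \<dots> r = (\<Sum>i<n. ball_integral n (\<lambda>x. (r\<^sup>2 - (vnorm n x)\<^sup>2) * D i x - 2 * x i * V i x) r)"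
      using r by (intro ball_integral_sum continuous_intros D V) auto
    also have "\<dots> = 0"
      by (intro sum.neutral ballI integral_partial_cutoff_eq_0 r V D VD) auto
    finally show ?thesis .
  qed
  \<comment> \<open>This is the cancellation behind the boundary form: when \<open>eq\<close> is
    differentiated, the term from \<open>R\<^sup>2\<close> times the derivative of the integral of
    \<open>v\<close> cancels the derivative of the integral of \<open>u\<close>, and only
    \<open>2 * R\<close> times the integral of \<open>v\<close> and the mean of \<open>b\<close>
    survive.\<close>
  have mu: "sphere_mean n u R = R\<^sup>2 * sphere_mean n v R"
    unfolding sphere_mean_cmult[symmetric] using R by (intro sphere_mean_cong) (auto simp: u_def)
  have "((\<lambda>r. r\<^sup>2 * ball_integral n v r - ball_integral n u r - 2 * ball_integral n b r) has_real_derivative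
      2 * R * ball_integral n v R + (n * R ^ (n - 1) * (ball_volume n * sphere_mean n v R)) * R\<^sup>2
      - n * R ^ (n - 1) * (ball_volume n * sphere_mean n u R)
      - 2 * (n * R ^ (n - 1) * (ball_volume n * sphere_mean n b R))) (at R)"
    by (rule derivative_eq_intros ball_integral_has_derivative n cv cu cb R refl)+ simp
  then have "((\<lambda>r. 0) has_real_derivative
      2 * R * ball_integral n v R + (n * R ^ (n - 1) * (ball_volume n * sphere_mean n v R)) * R\<^sup>2
      - n * R ^ (n - 1) * (ball_volume n * sphere_mean n u R)
      - 2 * (n * R ^ (n - 1) * (ball_volume n * sphere_mean n b R))) (at R)"
    by (rule DERIV_cong_ev[THEN iffD1, rotated -1])
       (use R eq in \<open>auto intro!: eventually_mono[OF eventually_nhds_in_open[of "{0<..<1}" R]]\<close>)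
  from DERIV_unique[OF this DERIV_const] show ?thesis
    unfolding mu v_def[symmetric] b_def[symmetric] by simp
qed

subsection \<open>The hyperbolic Green function\<close>

lemma hyp_green_integrand_continuous:
  assumes "0 < a"
  shows "continuous_on {a..b} (\<lambda>s::real. (1 - s\<^sup>2) ^ (n - 2) / s ^ (n - 1))"
  using assms by (intro continuous_intros) auto

lemma hyp_green_refl [simp]: "hyp_green n r r = 0"
  by (simp add: hyp_green_def)

lemma hyp_green_has_derivative:
  assumes "0 < s" "s < r"
  shows "((\<lambda>s. hyp_green n s r) has_real_derivative - (1 / n) * ((1 - s\<^sup>2) ^ (n - 2) / s ^ (n - 1))) (at s)"
proof -
  let ?h = "\<lambda>s::real. (1 - s\<^sup>2) ^ (n - 2) / s ^ (n - 1)"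
  have "((\<lambda>x. integral {x..r} ?h) has_real_derivative - ?h s) (at s within {s/2..r})"
    by (rule integral_has_real_derivative'[OF hyp_green_integrand_continuous]) (use assms in auto)
  then have "((\<lambda>x. integral {x..r} ?h) has_real_derivative - ?h s) (at s)"
    using assms by (subst (asm) at_within_Icc_at) auto
  from DERIV_cmult[OF this, of "1 / n"] show ?thesis
    unfolding hyp_green_def by (rule DERIV_cong) simp
qed

lemma continuous_on_hyp_green:
  assumes "0 < r"
  shows "continuous_on {0<..r} (\<lambda>s. hyp_green n s r)"
proof -
  let ?h = "\<lambda>s::real. (1 - s\<^sup>2) ^ (n - 2) / s ^ (n - 1)"
  have "continuous (at s within {0<..r}) (\<lambda>s. hyp_green n s r)" if s: "s \<in> {0<..r}" for s
  proof -
    have "((\<lambda>x. integral {x..r} ?h) has_real_derivative - ?h s) (at s within {s/2..r})"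
      by (rule integral_has_real_derivative'[OF hyp_green_integrand_continuous]) (use s in auto)
    then have "continuous (at s within {s/2..r}) (\<lambda>x. integral {x..r} ?h)"
      by (rule DERIV_continuous)
    moreover have "at s within {s/2..r} = at s within {0<..r}"
      by (rule at_within_nhd[of _ "{s/2<..}"]) (use s in auto)
    ultimately have "continuous (at s within {0<..r}) (\<lambda>x. integral {x..r} ?h)"
      by simp
    then show ?thesis
      unfolding hyp_green_def by (rule continuous_mult_left)
  qed
  then show ?thesis
    by (simp add: continuous_on_eq_continuous_within)
qed

lemma hyp_green_nonneg:
  assumes "0 < s" "r \<le> 1"
  shows "0 \<le> hyp_green n s r"
proof -
  have "0 \<le> integral {s..r} (\<lambda>s. (1 - s\<^sup>2) ^ (n - 2) / s ^ (n - 1))"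
  proof (rule integral_nonneg)
    show "(\<lambda>s::real. (1 - s\<^sup>2) ^ (n - 2) / s ^ (n - 1)) integrable_on {s..r}"
      by (rule integrable_continuous_real[OF hyp_green_integrand_continuous[OF assms(1)]])
    show "0 \<le> (1 - t\<^sup>2) ^ (n - 2) / t ^ (n - 1)" if "t \<in> {s..r}" for t
    proof -
      have "0 \<le> t" "t\<^sup>2 \<le> 1"
        using that assms by (simp_all add: abs_square_le_1)
      then show ?thesis
        by simp
    qed
  qed
  then show ?thesis
    by (simp add: hyp_green_def)
qed

text \<open>Since \<open>s (1 + t) \<le> t (1 + s)\<close> for \<open>s \<le> t\<close>, the integrand at \<open>t\<close> is at most its value at
  \<open>s\<close> times \<open>((1 - t) / (1 - s))\<^bsup>n-2\<^esup>\<close>.\<close>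

lemma hyp_green_upper:
  assumes n: "2 \<le> n" and s: "0 < s" "s \<le> r" "r < 1"
  shows "n * s ^ (n - 1) * hyp_green n s r \<le> (1 - s\<^sup>2) ^ (n - 2) * (1 - s) / (real n - 1)"
proof -
  define m where "m = n - 2"
  have nm: "n = m + 2" using n by (simp add: m_def)
  have s1: "s < 1" using s by simp
  have "integral {s..r} (\<lambda>t. (1 - t\<^sup>2) ^ (n - 2) / t ^ (n - 1))
     \<le> integral {s..r} (\<lambda>t. (1 + s) ^ m / s ^ (m + 1) * (1 - t) ^ m)"
  proof (rule integral_le)
    show "(\<lambda>t. (1 - t\<^sup>2) ^ (n - 2) / t ^ (n - 1)) integrable_on {s..r}"
      by (rule integrable_continuous_real[OF hyp_green_integrand_continuous[OF s(1)]])
    show "(\<lambda>t. (1 + s) ^ m / s ^ (m + 1) * (1 - t) ^ m) integrable_on {s..r}"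
      by (intro integrable_continuous_real continuous_intros)
    fix t assume t: "t \<in> {s..r}"
    then have t0: "0 < t" "t < 1" "s \<le> t" using s by auto
    have "s * (1 + t) \<le> t * (1 + s)"
      using t0 by (simp add: algebra_simps)
    then have "(s * (1 + t)) ^ m \<le> (t * (1 + s)) ^ m"
      using t0 s by (intro power_mono) auto
    then have "(s * (1 + t)) ^ m * s \<le> (t * (1 + s)) ^ m * t"
      by (rule mult_mono) (use t0 s in auto)
    then have "(1 + t) ^ m * s ^ (m + 1) \<le> (1 + s) ^ m * t ^ (m + 1)"
      by (simp add: power_mult_distrib mult_ac)
    then have "(1 + t) ^ m / t ^ (m + 1) \<le> (1 + s) ^ m / s ^ (m + 1)"
      using t0 s by (simp add: divide_le_eq le_divide_eq mult_ac del: power_Suc add_Suc_right One_nat_def)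
    then have "(1 + t) ^ m / t ^ (m + 1) * (1 - t) ^ m \<le> (1 + s) ^ m / s ^ (m + 1) * (1 - t) ^ m"
      using t0 by (intro mult_right_mono) auto
    moreover have "1 - t\<^sup>2 = (1 + t) * (1 - t)"
      by (simp add: power2_eq_square algebra_simps)
    ultimately show "(1 - t\<^sup>2) ^ (n - 2) / t ^ (n - 1) \<le> (1 + s) ^ m / s ^ (m + 1) * (1 - t) ^ m"
      by (simp add: nm power_mult_distrib)
  qed
  also have "\<dots> = (1 + s) ^ m / s ^ (m + 1) * (((1 - s) ^ (m + 1) - (1 - r) ^ (m + 1)) / (m + 1))"
  proof -
    have "((\<lambda>t. (1 - t) ^ m) has_integral (- ((1 - r) ^ (m + 1)) / (m + 1) - (- ((1 - s) ^ (m + 1)) / (m + 1))))  {s..r}"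
    proof (rule fundamental_theorem_of_calculus)
      fix t assume "t \<in> {s..r}"
      have "((\<lambda>t. - ((1 - t) ^ (m + 1)) / (m + 1)) has_real_derivative (1 - t) ^ m) (at t within {s..r})"
      proof -
        have "((\<lambda>t. 1 - t) has_real_derivative - 1) (at t within {s..r})"
          by (auto intro!: derivative_eq_intros)
        from DERIV_cdivide[OF DERIV_minus[OF DERIV_power[OF this, of "m + 1"]], of "real (m + 1)"]
        show ?thesis by (rule DERIV_cong) simp
      qed
      then show "((\<lambda>t. - ((1 - t) ^ (m + 1)) / (m + 1)) has_vector_derivative (1 - t) ^ m) (at t within {s..r})"
        by (simp add: has_real_derivative_iff_has_vector_derivative)
    qed (use s in simp)
    then have "integral {s..r} (\<lambda>t. (1 - t) ^ m) = ((1 - s) ^ (m + 1) - (1 - r) ^ (m + 1)) / (m + 1)"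
      by (simp add: integral_unique diff_divide_distrib)
    then show ?thesis by simp
  qed
  \<comment> \<open>Dropping \<open>(1 - r) ^ (m + 1)\<close> makes the bound independent of
    r.\<close>
  also have "\<dots> \<le> (1 + s) ^ m / s ^ (m + 1) * ((1 - s) ^ (m + 1) / (m + 1))"
    using s by (intro mult_left_mono divide_right_mono) auto
  finally have "s ^ (m + 1) * integral {s..r} (\<lambda>t. (1 - t\<^sup>2) ^ (n - 2) / t ^ (n - 1))
     \<le> s ^ (m + 1) * ((1 + s) ^ m / s ^ (m + 1) * ((1 - s) ^ (m + 1) / (m + 1)))"
    using s by (intro mult_left_mono) auto
  also have "\<dots> = ((1 + s) * (1 - s)) ^ m * (1 - s) / (m + 1)"
    using s by (simp add: power_mult_distrib)
  also have "(1 + s) * (1 - s) = 1 - s\<^sup>2"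
    by (simp add: power2_eq_square algebra_simps)
  finally show ?thesis
    using n by (simp add: hyp_green_def nm)
qed

text \<open>Near 0 the left side is of order s for n > 2 and of order \<open>s log (1/s)\<close> for
  n = 2; \<open>sqrt s\<close> dominates both. Bounding \<open>t ^ (m + 1)\<close> below by
  \<open>s ^ m * sqrt s * sqrt t\<close>, with m = n - 2, leaves the integral of
  \<open>1 / sqrt t\<close> and avoids a separate logarithmic case.\<close>

lemma hyp_green_vanishing:
  assumes n: "2 \<le> n" and s: "0 < s" "s \<le> r" "r < 1"
  shows "s ^ (n - 1) * hyp_green n s r \<le> 2 / n * sqrt s"
proof -
  define m where "m = n - 2"
  have nm: "n = m + 2" using n by (simp add: m_def)
  have "integral {s..r} (\<lambda>t. (1 - t\<^sup>2) ^ (n - 2) / t ^ (n - 1))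
     \<le> integral {s..r} (\<lambda>t. 1 / (s ^ m * sqrt s) * (1 / sqrt t))"
  proof (rule integral_le)
    show "(\<lambda>t. (1 - t\<^sup>2) ^ (n - 2) / t ^ (n - 1)) integrable_on {s..r}"
      by (rule integrable_continuous_real[OF hyp_green_integrand_continuous[OF s(1)]])
    show "(\<lambda>t. 1 / (s ^ m * sqrt s) * (1 / sqrt t)) integrable_on {s..r}"
      by (intro integrable_continuous_real continuous_intros) (use s in auto)
    fix t assume t: "t \<in> {s..r}"
    then have t0: "0 < t" "t < 1" "s \<le> t" using s by auto
    have "(1 - t\<^sup>2) ^ m \<le> 1"
      using t0 by (intro power_le_one) (auto simp: abs_square_le_1)
    then have "(1 - t\<^sup>2) ^ (n - 2) / t ^ (n - 1) \<le> 1 / t ^ (m + 1)"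
      using t0 by (simp add: nm divide_right_mono)
    also have "\<dots> \<le> 1 / (s ^ m * sqrt s * sqrt t)"
    proof -
      have "s ^ m * (sqrt s * sqrt t) \<le> t ^ m * (sqrt t * sqrt t)"
        using t0 s by (intro mult_mono power_mono) auto
      then show ?thesis
        using t0 s by (intro divide_left_mono) (auto simp: mult_ac)
    qed
    finally show "(1 - t\<^sup>2) ^ (n - 2) / t ^ (n - 1) \<le> 1 / (s ^ m * sqrt s) * (1 / sqrt t)"
      by simp
  qed
  also have "\<dots> = 1 / (s ^ m * sqrt s) * (2 * sqrt r - 2 * sqrt s)"
  proof -
    have "((\<lambda>t. 1 / sqrt t) has_integral (2 * sqrt r - 2 * sqrt s)) {s..r}"
    proof (rule fundamental_theorem_of_calculus)
      fix t assume "t \<in> {s..r}"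
      then have "0 < t" using s by simp
      then have "((\<lambda>t. 2 * sqrt t) has_real_derivative 1 / sqrt t) (at t within {s..r})"
        by (auto intro!: derivative_eq_intros simp: field_simps)
      then show "((\<lambda>t. 2 * sqrt t) has_vector_derivative 1 / sqrt t) (at t within {s..r})"
        by (simp add: has_real_derivative_iff_has_vector_derivative)
    qed (use s in simp)
    then show ?thesis
      by (subst integral_mult_right) (simp add: integral_unique)
  qed
  also have "\<dots> \<le> 1 / (s ^ m * sqrt s) * 2"
  proof (rule mult_left_mono)
    have "sqrt r \<le> 1" "0 \<le> sqrt s"
      using s by (simp_all add: real_sqrt_le_1_iff)
    then show "2 * sqrt r - 2 * sqrt s \<le> 2" by linarith
  qed (use s in auto)
  finally have "s ^ (m + 1) * integral {s..r} (\<lambda>t. (1 - t\<^sup>2) ^ (n - 2) / t ^ (n - 1))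
     \<le> s ^ (m + 1) * (1 / (s ^ m * sqrt s) * 2)"
    using s by (intro mult_left_mono) auto
  also have "\<dots> = 2 * sqrt s"
    using s by (simp add: field_simps real_sqrt_mult[symmetric])
  finally have "1 / n * (s ^ (m + 1) * integral {s..r} (\<lambda>t. (1 - t\<^sup>2) ^ (n - 2) / t ^ (n - 1))) \<le> 1 / n * (2 * sqrt s)"
    by (rule mult_left_mono) simp
  then show ?thesis
    by (simp add: hyp_green_def nm)
qed

lemma continuous_on_green_kernel:
  assumes n: "2 \<le> n" and r: "0 \<le> r" "r < 1"
  shows "continuous_on {0..r} (\<lambda>s. s ^ (n - 1) * hyp_green n s r)"
proof -
  let ?k = "\<lambda>s. s ^ (n - 1) * hyp_green n s r"
  have "continuous (at s within {0..r}) ?k" if s: "s \<in> {0..r}" for s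
  proof (cases "s = 0")
    case False
    then have "0 < s" "0 < r" using s by auto
    then have "continuous (at s within {0<..r}) (\<lambda>s. hyp_green n s r)"
      using continuous_on_hyp_green[of r n] s by (simp add: continuous_on_eq_continuous_within)
    moreover have "at s within {0<..r} = at s within {0..r}"
      by (rule at_within_nhd[of _ "{0<..}"]) (use s \<open>0 < s\<close> in auto)
    ultimately show ?thesis
      by (intro continuous_intros) simp
  next
    case True
    have "(?k \<longlongrightarrow> 0) (at 0 within {0..r})"
    proof (rule Lim_null_comparison)
      have "norm (?k t) \<le> 2 / n * sqrt t" if "t \<in> {0..r}" "t \<noteq> 0" for t
        using hyp_green_vanishing[OF n, of t r] hyp_green_nonneg[of t r n] that r by auto
      then show "\<forall>\<^sub>F t in at 0 within {0..r}. norm (?k t) \<le> 2 / n * sqrt t"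
        by (auto simp: eventually_at_filter)
      have "((\<lambda>t. 2 / n * sqrt t) \<longlongrightarrow> 2 / n * sqrt 0) (at 0 within {0..r})"
        by (intro tendsto_intros)
      then show "((\<lambda>t. 2 / n * sqrt t) \<longlongrightarrow> 0) (at 0 within {0..r})"
        by simp
    qed
    \<comment> \<open>The factor \<open>0 ^ (n - 1)\<close> is 0, whatever value
      \<open>hyp_green n 0 r\<close> takes, where the integrand is singular.\<close>
    moreover have "?k 0 = 0"
      using n by simp
    ultimately show ?thesis
      unfolding True continuous_within by (simp only:)
  qed
  then show ?thesis
    by (simp add: continuous_on_eq_continuous_within)
qed

subsection \<open>Green's formula for spherical means\<close>

text \<open>The radial calculus for a general u with gradient \<open>G\<close>. \<open>D i\<close>
  is the i-th derivative of the i-th component of the weighted gradient, so the sum of the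
  \<open>D i\<close> is the divergence that stands for \<open>(1 - |x|^2)^(-n)\<close> times the
  hyperbolic Laplacian of u.\<close>

locale radial_green =
  fixes n :: nat and u :: "(nat \<Rightarrow> real) \<Rightarrow> real"
    and G :: "nat \<Rightarrow> (nat \<Rightarrow> real) \<Rightarrow> real" and D :: "nat \<Rightarrow> (nat \<Rightarrow> real) \<Rightarrow> real"
  assumes n: "2 \<le> n"
    and u: "continuous_on (unit_ball n) u"
    and G: "\<And>i. i < n \<Longrightarrow> continuous_on (unit_ball n) (G i)"
    and D: "\<And>i. i < n \<Longrightarrow> continuous_on (unit_ball n) (D i)"
    and uG: "\<And>i x. i < n \<Longrightarrow> x \<in> unit_ball n \<Longrightarrow>
               ((\<lambda>t. u (x(i := t))) has_real_derivative G i x) (at (x i))"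
    and GD: "\<And>i x. i < n \<Longrightarrow> x \<in> unit_ball n \<Longrightarrow>
               ((\<lambda>t. G i (x(i := t)) / (1 - (vnorm n (x(i := t)))\<^sup>2) ^ (n - 2))
                 has_real_derivative D i x) (at (x i))"
begin

abbreviation "mean \<equiv> sphere_mean n u"
abbreviation "flux \<equiv> ball_integral n (\<lambda>x. \<Sum>i<n. D i x)"

lemma n_pos: "0 < n" using n by simp

lemma continuous_D: "continuous_on (unit_ball n) (\<lambda>x. \<Sum>i<n. D i x)"
  by (intro continuous_on_sum D) simp

lemma weight_pos: "x \<in> unit_ball n \<Longrightarrow> 0 < 1 - (vnorm n x)\<^sup>2"
  by (simp add: unit_ball_def abs_square_less_1)

text \<open>Instead of differentiating along rays under the integral sign, the divergence theorem is
  applied to the field \<open>u(x) x\<close>. Its divergence is \<open><grad u, x> + n u\<close> and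
  its radial part on the sphere of radius r is governed by \<open>r\<^sup>2 * u x\<close>, so
  \<open>mean\<close> becomes a ball integral divided by a multiple of \<open>r ^ n\<close>. In the
  quotient rule the term \<open>n u\<close> cancels against the derivative of
  \<open>r ^ n\<close>.\<close>

lemma radial_derivative:
  assumes s: "0 < s" "s < 1"
  shows "(mean has_real_derivative sphere_mean n (\<lambda>x. \<Sum>i<n. G i x * x i) s / s) (at s)"
proof -
  define b where "b = (\<lambda>x. \<Sum>i<n. G i x * x i)"
  define k where "k = n * ball_volume n"
  have k: "k > 0"
    using n_pos ball_volume_pos[of n] by (simp add: k_def)
  define P where "P = ball_integral n (\<lambda>x. \<Sum>i<n. G i x * x i + u x)"
  have cont: "continuous_on (unit_ball n) (\<lambda>x. \<Sum>i<n. G i x * x i + u x)"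
    by (intro continuous_intros G u) simp
  have cb: "continuous_on (unit_ball n) b"
    unfolding b_def by (intro continuous_intros G) simp
  have P: "P r = k * r ^ n * mean r" if r: "0 < r" "r < 1" for r
  proof -
    have "r * P r = n * r ^ (n - 1) * (ball_volume n * sphere_mean n (\<lambda>x. \<Sum>i<n. (u x * x i) * x i) r)"
      unfolding P_def
    proof (rule divergence_ball[OF n_pos r])
      fix i x assume i: "i < n" and x: "x \<in> unit_ball n"
      have "((\<lambda>t. u (x(i := t)) * t) has_real_derivative G i x * x i + 1 * u (x(i := x i))) (at (x i))"
        by (rule DERIV_mult[OF uG[OF i x] DERIV_ident])
      then show "((\<lambda>t. u (x(i := t)) * (x(i := t)) i) has_real_derivative G i x * x i + u x) (at (x i))"
        by simp
    qed (intro continuous_intros G u, assumption?)+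
    also have "sphere_mean n (\<lambda>x. \<Sum>i<n. (u x * x i) * x i) r = sphere_mean n (\<lambda>x. r\<^sup>2 * u x) r"
    proof (rule sphere_mean_cong)
      fix x assume "vnorm n x = r"
      then have "r\<^sup>2 * u x = u x * (\<Sum>i<n. (x i)\<^sup>2)"
        by (simp add: vnorm_square[symmetric])
      then show "(\<Sum>i<n. (u x * x i) * x i) = r\<^sup>2 * u x"
        by (simp add: sum_distrib_left power2_eq_square mult.assoc)
    qed (use r in auto)
    finally have "r * P r = r * (k * (r ^ (n - 1) * r) * mean r)"
      by (simp only: sphere_mean_cmult k_def power2_eq_square mult_ac)
    also have "r ^ (n - 1) * r = r ^ n"
      using n_pos power_minus_mult by blast
    finally show ?thesis
      using r by simp
  qed
  have "sphere_mean n (\<lambda>x. \<Sum>i<n. G i x * x i + u x) s = sphere_mean n (\<lambda>x. b x + n * u x) s"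
    by (simp add: b_def sum.distrib)
  also have "\<dots> = sphere_mean n b s + n * mean s"
    using s by (subst sphere_mean_add) (auto simp: sphere_mean_cmult cb u intro!: continuous_intros)
  finally have "(P has_real_derivative n * s ^ (n - 1) * (ball_volume n * (sphere_mean n b s + n * mean s))) (at s)"
    using ball_integral_has_derivative[OF n_pos cont s] by (simp add: P_def)
  moreover have "((\<lambda>r. k * r ^ n) has_real_derivative k * (n * s ^ (n - 1))) (at s)"
    by (auto intro!: derivative_eq_intros)
  ultimately have "((\<lambda>r. P r / (k * r ^ n)) has_real_derivative
      (n * s ^ (n - 1) * (ball_volume n * (sphere_mean n b s + n * mean s)) * (k * s ^ n) - P s * (k * (n * s ^ (n - 1))))
        / ((k * s ^ n) * (k * s ^ n))) (at s)"
    using s k by (intro DERIV_divide) auto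
  also have "(n * s ^ (n - 1) * (ball_volume n * (sphere_mean n b s + n * mean s)) * (k * s ^ n) - P s * (k * (n * s ^ (n - 1))))
        / ((k * s ^ n) * (k * s ^ n)) = s ^ (n - 1) / s ^ n * sphere_mean n b s"
    using s n_pos ball_volume_pos[of n] by (simp add: P field_simps k_def)
  also have "s ^ (n - 1) / s ^ n = 1 / s"
    using n_pos s by (cases n) simp_all
  finally have "((\<lambda>r. P r / (k * r ^ n)) has_real_derivative sphere_mean n b s / s) (at s)"
    by simp
  moreover have "\<forall>\<^sub>F r in nhds s. P r / (k * r ^ n) = mean r"
  proof -
    have "\<forall>\<^sub>F r in nhds s. r \<in> {0<..<1}"
      by (rule eventually_nhds_in_open) (use s in auto)
    then show ?thesis
      by eventually_elim (use k in \<open>simp add: P\<close>)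
  qed
  ultimately show ?thesis
    unfolding b_def by (subst (asm) DERIV_cong_ev[OF refl _ refl])
qed

text \<open>The divergence theorem for the weighted gradient: on a sphere the weight is constant and
  leaves the mean, and what remains is the radial derivative just computed.\<close>

lemma mean_has_derivative:
  assumes s: "0 < s" "s < 1"
  shows "(mean has_real_derivative (1 - s\<^sup>2) ^ (n - 2) / s ^ (n - 1) * flux s / (n * ball_volume n)) (at s)"
proof -
  define w where "w = (1 - s\<^sup>2) ^ (n - 2)"
  have w: "0 < w"
    using s by (simp add: w_def abs_square_less_1)
  have "s * flux s = n * s ^ (n - 1) * (ball_volume n *
      sphere_mean n (\<lambda>x. \<Sum>i<n. (G i x / (1 - (vnorm n x)\<^sup>2) ^ (n - 2)) * x i) s)"
  proof (rule divergence_ball[OF n_pos s])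
    show "continuous_on (unit_ball n) (\<lambda>x. G i x / (1 - (vnorm n x)\<^sup>2) ^ (n - 2))" if "i < n" for i
      using weight_pos by (intro continuous_intros G that) force
  qed (simp_all add: D GD)
  also have "sphere_mean n (\<lambda>x. \<Sum>i<n. (G i x / (1 - (vnorm n x)\<^sup>2) ^ (n - 2)) * x i) s
     = sphere_mean n (\<lambda>x. 1 / w * (\<Sum>i<n. G i x * x i)) s"
    using s by (intro sphere_mean_cong) (simp_all add: w_def sum_divide_distrib)
  finally have "s * flux s = n * s ^ (n - 1) * (ball_volume n * (1 / w * sphere_mean n (\<lambda>x. \<Sum>i<n. G i x * x i) s))"
    by (simp only: sphere_mean_cmult)
  then have "sphere_mean n (\<lambda>x. \<Sum>i<n. G i x * x i) s / s = w / s ^ (n - 1) * flux s / (n * ball_volume n)"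
    using s w n_pos ball_volume_pos[of n] by (simp add: field_simps)
  then show ?thesis
    using radial_derivative[OF s] by (simp add: w_def)
qed

lemma continuous_on_mean: "continuous_on {0..<1} mean"
  by (rule continuous_on_sphere_mean[OF n_pos u])

lemma mean_mono:
  assumes "\<And>x. x \<in> unit_ball n \<Longrightarrow> 0 \<le> (\<Sum>i<n. D i x)" "0 \<le> a" "a \<le> b" "b < 1"
  shows "mean a \<le> mean b"
proof (cases "a = b")
  case False
  show ?thesis
  proof (rule DERIV_nonneg_imp_increasing_open[where f = mean])
    show "continuous_on {a..b} mean"
      using continuous_on_mean by (rule continuous_on_subset) (use assms in auto)
    fix s assume s: "a < s" "s < b"
    then have s1: "0 < s" "s < 1" using assms by auto
    have "0 \<le> (1 - s\<^sup>2) ^ (n - 2) / s ^ (n - 1) * flux s / (n * ball_volume n)"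
      using s1 ball_volume_pos[of n] assms(1)
      by (intro divide_nonneg_nonneg mult_nonneg_nonneg ball_integral_nonneg zero_le_power)
         (auto simp: abs_square_le_1)
    then show "\<exists>y. (mean has_real_derivative y) (at s) \<and> 0 \<le> y"
      using mean_has_derivative[OF s1] by blast
  qed (use assms in simp)
qed simp

text \<open>By \<open>mean_has_derivative\<close>, minus the derivative of
  \<open>hyp_green n s r\<close> in s is exactly the factor of \<open>flux s / ball_volume n\<close>
  in the derivative of \<open>mean\<close>. In the derivative of \<open>\<Phi>\<close> these two
  terms cancel, and only the Green function times the derivative of the flux remains. At r the Green
  function vanishes, and at 0 the flux does.\<close>

theorem green_formula:
  assumes r: "0 \<le> r" "r < 1"
  shows "((\<lambda>s. n * (s ^ (n - 1) * hyp_green n s r) * sphere_mean n (\<lambda>x. \<Sum>i<n. D i x) s)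
           has_integral (mean r - u (\<lambda>_. 0))) {0..r}"
proof -
  define \<kappa> where "\<kappa> = ball_volume n"
  have \<kappa>: "\<kappa> > 0"
    using ball_volume_pos[of n] by (simp add: \<kappa>_def)
  define \<Phi> where "\<Phi> = (\<lambda>s. hyp_green n s r * (flux s / \<kappa>) + mean s)"
  have flux0: "flux 0 = 0"
    by (simp add: ball_integral_def oball_def not_less)
  \<comment> \<open>At 0 the singularity of the Green function is beaten by the flux: the flux is of
    order \<open>s ^ n\<close>, and \<open>s ^ (n - 1) * hyp_green n s r\<close> is at most a
    multiple of \<open>sqrt s\<close>.\<close>
  have cont: "continuous_on {0..r} (\<lambda>s. hyp_green n s r * (flux s / \<kappa>))"
  proof -
    have "continuous (at s within {0..r}) (\<lambda>s. hyp_green n s r * (flux s / \<kappa>))" if s: "s \<in> {0..r}" for s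
    proof (cases "s = 0")
      case False
      then have "0 < s" "0 < r" "s < 1" using s r by auto
      then have "continuous (at s within {0<..r}) (\<lambda>s. hyp_green n s r)"
        using continuous_on_hyp_green[of r n] s by (simp add: continuous_on_eq_continuous_within)
      moreover have "at s within {0<..r} = at s within {0..r}"
        by (rule at_within_nhd[of _ "{0<..}"]) (use s \<open>0 < s\<close> in auto)
      moreover have "continuous (at s within {0..r}) flux"
        by (rule continuous_at_imp_continuous_at_within[OF DERIV_isCont[OF
              ball_integral_has_derivative[OF n_pos continuous_D \<open>0 < s\<close> \<open>s < 1\<close>]]])
      ultimately show ?thesis
        using \<kappa> by (intro continuous_intros) auto
    next
      case True
      obtain K where K: "0 \<le> K" "\<And>x. x \<in> kball n r \<Longrightarrow> \<bar>\<Sum>i<n. D i x\<bar> \<le> K"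
        using continuous_on_kball_bounded[OF continuous_D r(2)] by blast
      have "((\<lambda>s. hyp_green n s r * (flux s / \<kappa>)) \<longlongrightarrow> 0) (at 0 within {0..r})"
      proof (rule Lim_null_comparison)
        have "norm (hyp_green n t r * (flux t / \<kappa>)) \<le> 2 / n * sqrt t * K * t" if "t \<in> {0..r}" "t \<noteq> 0" for t
        proof -
          have t: "0 < t" "t \<le> r" using that by auto
          have "\<bar>flux t\<bar> \<le> K * t ^ n * \<kappa>"
            unfolding \<kappa>_def by (rule ball_integral_bound[OF n_pos continuous_D t r(2) K(2)])
          then have "norm (hyp_green n t r * (flux t / \<kappa>)) \<le> hyp_green n t r * (K * t ^ n)"
            using hyp_green_nonneg[of t r n] t r \<kappa>
            by (simp add: abs_mult mult_left_mono pos_divide_le_eq mult.assoc)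
          also have "\<dots> = (t ^ (n - 1) * hyp_green n t r) * K * t"
            using n_pos by (simp add: power_eq_if)
          also have "\<dots> \<le> 2 / n * sqrt t * K * t"
            using hyp_green_vanishing[OF n t r(2)] t K(1) by (intro mult_right_mono) auto
          finally show ?thesis .
        qed
        then show "\<forall>\<^sub>F t in at 0 within {0..r}. norm (hyp_green n t r * (flux t / \<kappa>)) \<le> 2 / n * sqrt t * K * t"
          by (auto simp: eventually_at_filter)
        have "((\<lambda>t. 2 / n * sqrt t * K * t) \<longlongrightarrow> 2 / n * sqrt 0 * K * 0) (at 0 within {0..r})"
          by (intro tendsto_intros)
        then show "((\<lambda>t. 2 / n * sqrt t * K * t) \<longlongrightarrow> 0) (at 0 within {0..r})"
          by simp
      qed
      then show ?thesis
        unfolding True continuous_within by (simp add: flux0)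
    qed
    then show ?thesis
      by (simp add: continuous_on_eq_continuous_within)
  qed
  have "((\<lambda>s. n * (s ^ (n - 1) * hyp_green n s r) * sphere_mean n (\<lambda>x. \<Sum>i<n. D i x) s)
           has_integral (\<Phi> r - \<Phi> 0)) {0..r}"
  proof (rule fundamental_theorem_of_calculus_interior)
    show "continuous_on {0..r} \<Phi>"
      unfolding \<Phi>_def
      by (intro continuous_on_add cont continuous_on_subset[OF continuous_on_mean]) (use r in auto)
    fix s assume s: "s \<in> {0<..<r}"
    then have s1: "0 < s" "s < r" "s < 1" using r by auto
    have "(\<Phi> has_real_derivative
       - (1 / n) * ((1 - s\<^sup>2) ^ (n - 2) / s ^ (n - 1)) * (flux s / \<kappa>)
        + (n * s ^ (n - 1) * (ball_volume n * sphere_mean n (\<lambda>x. \<Sum>i<n. D i x) s) / \<kappa>) * hyp_green n s r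
        + (1 - s\<^sup>2) ^ (n - 2) / s ^ (n - 1) * flux s / (n * ball_volume n)) (at s)"
      unfolding \<Phi>_def
      by (intro DERIV_add DERIV_mult hyp_green_has_derivative DERIV_cdivide mean_has_derivative
            ball_integral_has_derivative n_pos continuous_D s1)
    then have "(\<Phi> has_real_derivative n * (s ^ (n - 1) * hyp_green n s r) * sphere_mean n (\<lambda>x. \<Sum>i<n. D i x) s) (at s)"
      by (rule DERIV_cong) (use \<kappa> in \<open>simp add: \<kappa>_def\<close>)
    then show "(\<Phi> has_vector_derivative n * (s ^ (n - 1) * hyp_green n s r) * sphere_mean n (\<lambda>x. \<Sum>i<n. D i x) s) (at s)"
      by (simp add: has_real_derivative_iff_has_vector_derivative)
  qed (use r in simp)
  moreover have "\<Phi> r = mean r" "\<Phi> 0 = u (\<lambda>_. 0)"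
    by (simp_all add: \<Phi>_def flux0 sphere_mean_zero n_pos)
  ultimately show ?thesis by simp
qed

end

subsection \<open>Powers of the absolute value\<close>

text \<open>For \<open>p = 2\<close> the power would be the junk value \<open>0 powr 0 = 0\<close> at the origin.\<close>

definition pow_deriv2 :: "real \<Rightarrow> real \<Rightarrow> real" where
  "pow_deriv2 p t = (if p = 2 then 1 else \<bar>t\<bar> powr (p - 2))"

text \<open>Used with a = p - 1 for the first derivative of the p-th power and with a = p - 2 for
  the second. At 0 the difference quotients are \<open>sgn h * \<bar>h\<bar> powr a\<close> and
  \<open>\<bar>h\<bar> powr a\<close>, which tend to 0 as a is positive.\<close>

lemma abs_powr_has_derivative:
  fixes a :: real
  assumes "0 < a"
  shows "((\<lambda>t. \<bar>t\<bar> powr (a + 1)) has_real_derivative (a + 1) * (sgn t * \<bar>t\<bar> powr a)) (at t)"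
    and "((\<lambda>t. sgn t * \<bar>t\<bar> powr (a + 1)) has_real_derivative (a + 1) * \<bar>t\<bar> powr a) (at t)"
proof -
  consider "t = 0" | "0 < t" | "t < 0" by linarith
  then have "((\<lambda>t. \<bar>t\<bar> powr (a + 1)) has_real_derivative (a + 1) * (sgn t * \<bar>t\<bar> powr a)) (at t) \<and>
    ((\<lambda>t. sgn t * \<bar>t\<bar> powr (a + 1)) has_real_derivative (a + 1) * \<bar>t\<bar> powr a) (at t)"
  proof cases
    case 1
    have lim: "((\<lambda>h. \<bar>h\<bar> powr a) \<longlongrightarrow> 0) (at (0::real))"
      using tendsto_powr'[of "\<lambda>h::real. \<bar>h\<bar>" 0 "at 0" "\<lambda>_. a" a] assms
      by (auto intro!: tendsto_eq_intros)
    have lim2: "((\<lambda>h. sgn h * \<bar>h\<bar> powr a) \<longlongrightarrow> 0) (at (0::real))"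
      by (rule Lim_null_comparison[OF _ lim]) (auto simp: abs_mult abs_sgn_eq)
    have "\<bar>h\<bar> powr (a + 1) / h = sgn h * \<bar>h\<bar> powr a" "sgn h * \<bar>h\<bar> powr (a + 1) / h = \<bar>h\<bar> powr a"
      if "h \<noteq> 0" for h :: real
      using that by (auto simp: powr_add sgn_if)
    then have "\<forall>\<^sub>F h in at 0. sgn h * \<bar>h\<bar> powr a = \<bar>h\<bar> powr (a + 1) / (h::real)"
      "\<forall>\<^sub>F h in at 0. \<bar>h\<bar> powr a = sgn h * \<bar>h\<bar> powr (a + 1) / (h::real)"
      by (auto simp: eventually_at_filter)
    with lim lim2 show ?thesis
      unfolding 1 has_field_derivative_iff
      by (auto intro: Lim_transform_eventually)
  next
    case 2
    have d: "((\<lambda>t. t powr (a + 1)) has_real_derivative (a + 1) * t powr a) (at t)"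
      using has_real_derivative_powr[OF 2, of "a + 1"] by simp
    have e: "\<forall>\<^sub>F s in nhds t. s \<in> {0<..}"
      by (rule eventually_nhds_in_open) (use 2 in auto)
    have "((\<lambda>t. \<bar>t\<bar> powr (a + 1)) has_real_derivative (a + 1) * t powr a) (at t)"
      by (rule DERIV_cong_ev[THEN iffD2, OF refl _ refl d]) (use e in \<open>auto elim: eventually_mono\<close>)
    moreover have "((\<lambda>t. sgn t * \<bar>t\<bar> powr (a + 1)) has_real_derivative (a + 1) * t powr a) (at t)"
      by (rule DERIV_cong_ev[THEN iffD2, OF refl _ refl d]) (use e in \<open>auto elim: eventually_mono\<close>)
    ultimately show ?thesis
      using 2 by simp
  next
    case 3
    have "((\<lambda>t. - t) has_real_derivative - 1) (at t)"
      by (auto intro!: derivative_eq_intros)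
    from DERIV_chain2[where f = "\<lambda>z. z powr (a + 1)" and g = "\<lambda>t. - t" and x = t,
        OF has_real_derivative_powr this] 3
    have d: "((\<lambda>t. (- t) powr (a + 1)) has_real_derivative - ((a + 1) * (- t) powr a)) (at t)"
      by simp
    have e: "\<forall>\<^sub>F s in nhds t. s \<in> {..<0}"
      by (rule eventually_nhds_in_open) (use 3 in auto)
    have "((\<lambda>t. \<bar>t\<bar> powr (a + 1)) has_real_derivative - ((a + 1) * (- t) powr a)) (at t)"
      by (rule DERIV_cong_ev[THEN iffD2, OF refl _ refl d]) (use e in \<open>auto elim: eventually_mono\<close>)
    moreover have "((\<lambda>t. sgn t * \<bar>t\<bar> powr (a + 1)) has_real_derivative - (- ((a + 1) * (- t) powr a))) (at t)"
      by (rule DERIV_cong_ev[THEN iffD2, OF refl _ refl DERIV_minus[OF d]]) (use e in \<open>auto elim: eventually_mono\<close>)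
    ultimately show ?thesis
      using 3 by simp
  qed
  then show "((\<lambda>t. \<bar>t\<bar> powr (a + 1)) has_real_derivative (a + 1) * (sgn t * \<bar>t\<bar> powr a)) (at t)"
    and "((\<lambda>t. sgn t * \<bar>t\<bar> powr (a + 1)) has_real_derivative (a + 1) * \<bar>t\<bar> powr a) (at t)"
    by blast+
qed

lemma abs_powr_deriv1:
  assumes "2 \<le> p"
  shows "((\<lambda>t. \<bar>t\<bar> powr p) has_real_derivative p * (sgn t * \<bar>t\<bar> powr (p - 1))) (at t)"
  using abs_powr_has_derivative(1)[of "p - 1" t] assms by simp

lemma abs_powr_deriv2:
  assumes "2 \<le> p"
  shows "((\<lambda>t. sgn t * \<bar>t\<bar> powr (p - 1)) has_real_derivative (p - 1) * pow_deriv2 p t) (at t)"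
proof (cases "p = 2")
  case True
  then have "(\<lambda>t. sgn t * \<bar>t\<bar> powr (p - 1)) = (\<lambda>t. t)"
    by (auto simp: fun_eq_iff sgn_if)
  then show ?thesis
    using True by (simp add: pow_deriv2_def)
next
  case False
  then show ?thesis
    using abs_powr_has_derivative(2)[of "p - 2" t] assms by (simp add: pow_deriv2_def)
qed

lemma continuous_on_abs_powr:
  "0 < p \<Longrightarrow> continuous_on A g \<Longrightarrow> continuous_on A (\<lambda>x. \<bar>g x :: real\<bar> powr p)"
  by (intro continuous_on_powr' continuous_intros) auto

lemma continuous_on_pow_deriv2:
  assumes "2 \<le> p" "continuous_on A g"
  shows "continuous_on A (\<lambda>x. pow_deriv2 p (g x))"
  using assms continuous_on_abs_powr[of "p - 2" A g] by (cases "p = 2") (simp_all add: pow_deriv2_def)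

text \<open>\<open>sgn\<close> jumps at 0, so continuity is read off from differentiability of the
  product.\<close>

lemma continuous_on_sgn_abs_powr:
  assumes "2 \<le> p" "continuous_on A g"
  shows "continuous_on A (\<lambda>x. sgn (g x :: real) * \<bar>g x\<bar> powr (p - 1))"
proof -
  have "continuous_on UNIV (\<lambda>t. sgn t * \<bar>t\<bar> powr (p - 1))"
    by (intro continuous_at_imp_continuous_on ballI DERIV_isCont[OF abs_powr_deriv2[OF assms(1)]])
  then show ?thesis
    using continuous_on_compose2[OF _ assms(2), of UNIV] by simp
qed

lemma sgn_abs_powr_mult: "sgn t * \<bar>t\<bar> powr (p - 1) * t = \<bar>t\<bar> powr p" for t :: real
proof (cases "t = 0")
  case False
  have "sgn t * \<bar>t\<bar> powr (p - 1) * t = \<bar>t\<bar> powr (p - 1) * \<bar>t\<bar> powr 1"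
    using False by (simp add: sgn_if)
  also have "\<dots> = \<bar>t\<bar> powr p"
    by (simp only: powr_add[symmetric]) simp
  finally show ?thesis .
qed simp

text \<open>Young's inequality with exponents \<open>p / (p - 2)\<close> and \<open>p / 2\<close>, normalised by \<open>m\<close> and \<open>c\<close>, replaces
  Hoelder's inequality for \<open>\<integral>\<bar>f\<bar>\<^bsup>p-2\<^esup> \<bar>\<nabla>f\<bar>\<^sup>2\<close>.\<close>

lemma pow_deriv2_young:
  assumes p: "2 \<le> p" and m: "0 < m" and c: "0 < c" and Y: "0 \<le> Y"
  shows "pow_deriv2 p x * Y\<^sup>2 \<le> m powr (p - 2) * c\<^sup>2 *
           ((1 - 2 / p) / m powr p * \<bar>x\<bar> powr p + 2 / p / c powr p * Y powr p)"
proof (cases "p = 2")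
  case True
  then show ?thesis
    using m c Y by (simp add: pow_deriv2_def)
next
  case False
  then have p2: "2 < p" using p by simp
  show ?thesis
  proof (cases "x = 0 \<or> Y = 0")
    case True
    moreover have "0 \<le> m powr (p - 2) * c\<^sup>2 * ((1 - 2 / p) / m powr p * \<bar>x\<bar> powr p + 2 / p / c powr p * Y powr p)"
      using p by (intro mult_nonneg_nonneg add_nonneg_nonneg divide_nonneg_nonneg) auto
    ultimately show ?thesis
      using p2 by (auto simp: pow_deriv2_def)
  next
    case False
    then have x: "0 < \<bar>x\<bar>" and Y0: "0 < Y" using Y by auto
    define a where "a = \<bar>x\<bar> powr p / m powr p"
    define b where "b = Y powr p / c powr p"
    have ab: "0 < a" "0 < b"
      using x Y0 m c by (simp_all add: a_def b_def)
    have "a powr (1 - 2 / p) * b powr (2 / p) \<le> (1 - 2 / p) * a + 2 / p * b"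
      using p2 by (intro Youngs_inequality_0 ab) auto
    moreover have "a powr (1 - 2 / p) = \<bar>x\<bar> powr (p - 2) / m powr (p - 2)"
      using p2 by (simp add: a_def powr_divide powr_powr right_diff_distrib)
    moreover have "b powr (2 / p) = Y\<^sup>2 / c\<^sup>2"
      using p2 Y0 c by (simp add: b_def powr_divide powr_powr powr_realpow[of _ 2, simplified])
    ultimately have "\<bar>x\<bar> powr (p - 2) / m powr (p - 2) * (Y\<^sup>2 / c\<^sup>2) \<le> (1 - 2 / p) * a + 2 / p * b"
      by simp
    then have "m powr (p - 2) * c\<^sup>2 * (\<bar>x\<bar> powr (p - 2) / m powr (p - 2) * (Y\<^sup>2 / c\<^sup>2))
      \<le> m powr (p - 2) * c\<^sup>2 * ((1 - 2 / p) * a + 2 / p * b)"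
      by (intro mult_left_mono) auto
    moreover have "m powr (p - 2) * c\<^sup>2 * (\<bar>x\<bar> powr (p - 2) / m powr (p - 2) * (Y\<^sup>2 / c\<^sup>2)) = pow_deriv2 p x * Y\<^sup>2"
      using p2 m c by (simp add: pow_deriv2_def)
    ultimately show ?thesis
      by (simp add: a_def b_def)
  qed
qed

subsection \<open>The radial supremum\<close>

lemma sphere_eq_image:
  assumes "0 < n" "0 \<le> t"
  shows "{x \<in> Rn n. vnorm n x = t} = vscale t ` unit_sphere n"
proof
  show "vscale t ` unit_sphere n \<subseteq> {x \<in> Rn n. vnorm n x = t}"
    using assms by (auto simp: unit_sphere_def vscale_in_Rn vnorm_vscale)
  show "{x \<in> Rn n. vnorm n x = t} \<subseteq> vscale t ` unit_sphere n"
  proof clarify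
    fix x assume x: "x \<in> Rn n" "t = vnorm n x"
    show "x \<in> vscale (vnorm n x) ` unit_sphere n"
    proof (cases "vnorm n x = 0")
      case True
      \<comment> \<open>For radius 0 any unit vector scales to the origin; the first basis vector
        exists because n is positive.\<close>
      define e where "e = (\<lambda>i::nat. if i = 0 then 1 else 0 :: real)"
      have "(vnorm n e)\<^sup>2 = (\<Sum>i<n. if i = 0 then 1 else 0)"
        unfolding vnorm_square by (rule sum.cong) (auto simp: e_def)
      also have "\<dots> = 1"
        using assms(1) by (simp add: sum.delta)
      finally have "vnorm n e = 1"
        using vnorm_nonneg[of n e] by (auto simp: power2_eq_1_iff)
      then have "e \<in> unit_sphere n"
        using assms(1) by (auto simp: unit_sphere_def topspace_Euclidean_space e_def)
      then show ?thesis
        using True x vnorm_eq_0_iff[OF x(1)] by (auto intro!: image_eqI[of _ _ e])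
    next
      case False
      then show ?thesis
        using radial_proj_in_unit_sphere[OF x(1)] by (metis image_eqI)
    qed
  qed
qed

lemma unit_sphere_nonempty:
  assumes "0 < n" shows "unit_sphere n \<noteq> {}"
proof -
  have "(\<lambda>_. 0) \<in> {x \<in> Rn n. vnorm n x = 0}"
    by (simp add: topspace_Euclidean_space)
  then show ?thesis
    using sphere_eq_image[OF assms, of 0] by auto
qed

text \<open>The index set no longer depends on t, so suprema at two radii can be compared direction
  by direction.\<close>

lemma radial_sup_eq: "0 < n \<Longrightarrow> 0 \<le> t \<Longrightarrow> radial_sup n l t = (SUP z\<in>unit_sphere n. l (vscale t z))"
  by (simp add: radial_sup_def sphere_eq_image image_image)

lemma bdd_above_on_sphere:
  fixes l :: "(nat \<Rightarrow> real) \<Rightarrow> real"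
  assumes "continuous_on (unit_ball n) l" "t \<in> {0..<1}"
  shows "bdd_above ((\<lambda>z. l (vscale t z)) ` unit_sphere n)"
  using compact_continuous_image[OF continuous_on_unit_sphere_vscale[OF assms] compact_unit_sphere]
  by (intro bounded_imp_bdd_above compact_imp_bounded)

lemma le_radial_sup:
  assumes "0 < n" "continuous_on (unit_ball n) l" "x \<in> unit_ball n"
  shows "l x \<le> radial_sup n l (vnorm n x)"
proof -
  have t: "vnorm n x \<in> {0..<1}" "x \<in> Rn n"
    using assms(3) by (auto simp: unit_ball_def)
  then obtain z where z: "z \<in> unit_sphere n" "x = vscale (vnorm n x) z"
    using sphere_eq_image[of n "vnorm n x"] assms(1) by auto
  have "l (vscale (vnorm n x) z) \<le> (SUP z\<in>unit_sphere n. l (vscale (vnorm n x) z))"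
    by (rule cSUP_upper[OF z(1) bdd_above_on_sphere[OF assms(2) t(1)]])
  then show ?thesis
    using z(2) radial_sup_eq[OF assms(1) vnorm_nonneg, of l n x] by simp
qed

lemma continuous_on_radial_sup:
  assumes n: "0 < n" and l: "continuous_on (unit_ball n) l"
  shows "continuous_on {0..<1} (radial_sup n l)"
  unfolding continuous_on_iff
proof (intro ballI allI impI)
  fix s e :: real assume s: "s \<in> {0..<1}" and e: "0 < e"
  define R where "R = (1 + s) / 2"
  have R: "s < R" "R < 1"
    using s by (simp_all add: R_def)
  have "0 < e / 2"
    using e by simp
  from uniformly_continuous_radially[OF l R(2) this] obtain d where d: "0 < d"
    "\<And>s s' z. s \<in> {0..R} \<Longrightarrow> s' \<in> {0..R} \<Longrightarrow> \<bar>s - s'\<bar> < d \<Longrightarrow> z \<in> unit_sphere n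
       \<Longrightarrow> \<bar>l (vscale s z) - l (vscale s' z)\<bar> < e / 2"
    by blast
  have key: "radial_sup n l a \<le> radial_sup n l b + e / 2"
    if "a \<in> {0..R}" "b \<in> {0..R}" "\<bar>a - b\<bar> < d" for a b
  proof -
    have ab: "a \<in> {0..<1}" "b \<in> {0..<1}" using that R by auto
    have "(SUP z\<in>unit_sphere n. l (vscale a z)) \<le> (SUP z\<in>unit_sphere n. l (vscale b z)) + e / 2"
    proof (rule cSUP_least[OF unit_sphere_nonempty[OF n]])
      fix z assume z: "z \<in> unit_sphere n"
      have "l (vscale b z) \<le> (SUP z\<in>unit_sphere n. l (vscale b z))"
        by (rule cSUP_upper[OF z bdd_above_on_sphere[OF l ab(2)]])
      then show "l (vscale a z) \<le> (SUP z\<in>unit_sphere n. l (vscale b z)) + e / 2"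
        using d(2)[OF that z] by linarith
    qed
    then show ?thesis
      using ab n by (simp add: radial_sup_eq)
  qed
  show "\<exists>d>0. \<forall>x'\<in>{0..<1}. dist x' s < d \<longrightarrow> dist (radial_sup n l x') (radial_sup n l s) < e"
  proof (intro exI[of _ "min d (R - s)"] conjI ballI impI)
    show "0 < min d (R - s)"
      using d(1) R by simp
    fix s' assume s': "s' \<in> {0..<1}" "dist s' s < min d (R - s)"
    then have "s \<in> {0..R}" "s' \<in> {0..R}" "\<bar>s - s'\<bar> < d" "\<bar>s' - s\<bar> < d"
      using s R by (auto simp: dist_real_def)
    then have "radial_sup n l s' \<le> radial_sup n l s + e / 2" "radial_sup n l s \<le> radial_sup n l s' + e / 2"
      using key by blast+
    then show "dist (radial_sup n l s') (radial_sup n l s) < e"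
      using e by (simp add: dist_real_def abs_less_iff)
  qed
qed

subsection \<open>The norm inequality\<close>

lemma Ck_on_2D:
  assumes "Ck_on n 2 U f"
  shows "continuous_on U f"
    and "\<And>i x. i < n \<Longrightarrow> x \<in> U \<Longrightarrow> ((\<lambda>t. f (x(i := t))) has_real_derivative partial i f x) (at (x i))"
    and "\<And>i. i < n \<Longrightarrow> continuous_on U (partial i f)"
    and "\<And>i x. i < n \<Longrightarrow> x \<in> U \<Longrightarrow>
           ((\<lambda>t. partial i f (x(i := t))) has_real_derivative partial i (partial i f) x) (at (x i))"
    and "\<And>i. i < n \<Longrightarrow> continuous_on U (partial i (partial i f))"
proof -
  have 2: "(2::nat) = Suc (Suc 0)" by simp
  note * = assms[unfolded 2 Ck_on.simps]
  show "continuous_on U f" "\<And>i. i < n \<Longrightarrow> continuous_on U (partial i f)"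
    "\<And>i. i < n \<Longrightarrow> continuous_on U (partial i (partial i f))"
    using * by blast+
  show "((\<lambda>t. f (x(i := t))) has_real_derivative partial i f x) (at (x i))" if "i < n" "x \<in> U" for i x
    using * that by (auto simp: partial_def DERIV_deriv_iff_real_differentiable)
  show "((\<lambda>t. partial i f (x(i := t))) has_real_derivative partial i (partial i f) x) (at (x i))"
    if "i < n" "x \<in> U" for i x
  proof -
    have "(\<lambda>t. partial i f (x(i := t))) differentiable (at (x i))"
      using * that by blast
    then show ?thesis
      unfolding partial_def[of i "partial i f"] by (simp add: DERIV_deriv_iff_real_differentiable)
  qed
qed

text \<open>The weight along a coordinate line, where A collects the squares of the other
  coordinates. With m = n - 2 the numerator \<open>2 * m * t\<close> becomes the coefficient of the
  first-order term in the hyperbolic Laplacian.\<close>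

lemma hyperbolic_weight_has_derivative:
  fixes A t :: real
  assumes "A + t\<^sup>2 < 1"
  shows "((\<lambda>t. 1 / (1 - (A + t\<^sup>2)) ^ m) has_real_derivative 2 * m * t / (1 - (A + t\<^sup>2)) ^ (m + 1)) (at t)"
proof -
  have w: "1 - (A + t\<^sup>2) \<noteq> 0" using assms by simp
  have d: "((\<lambda>t. 1 - (A + t\<^sup>2)) has_real_derivative - (2 * t)) (at t)"
    by (auto intro!: derivative_eq_intros)
  have "((\<lambda>t. inverse (1 - (A + t\<^sup>2)) ^ m) has_real_derivative
     m * (- (inverse (1 - (A + t\<^sup>2)) * - (2 * t) * inverse (1 - (A + t\<^sup>2))) * inverse (1 - (A + t\<^sup>2)) ^ (m - Suc 0))) (at t)"
    by (rule DERIV_power[OF DERIV_inverse'[OF d w]])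
  moreover have "m * (- (inverse (1 - (A + t\<^sup>2)) * - (2 * t) * inverse (1 - (A + t\<^sup>2))) * inverse (1 - (A + t\<^sup>2)) ^ (m - Suc 0))
     = 2 * real m * t / (1 - (A + t\<^sup>2)) ^ (m + 1)"
    by (cases m) (simp_all add: divide_inverse power_inverse mult_ac)
  moreover have "(\<lambda>t. 1 / (1 - (A + t\<^sup>2)) ^ m) = (\<lambda>t. inverse (1 - (A + t\<^sup>2)) ^ m)"
    by (simp add: fun_eq_iff inverse_eq_divide power_one_over)
  ultimately show ?thesis
    by (simp only:)
qed

section \<open>Majorants\<close>

lemma majorant_nonneg: "majorant \<omega> \<Longrightarrow> 0 \<le> t \<Longrightarrow> 0 \<le> \<omega> t"
  by (simp add: majorant_def)

text \<open>\<open>\<omega> t / t\<close> at \<open>t = 1 / (1 - s)\<close> is at most its value at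
  1. One of the two factors from the squared gradient bound is thus traded, together with the factor
  \<open>1 - s\<close> of the Green kernel, for \<open>\<omega> 1\<close>.\<close>

lemma majorant_square_le:
  assumes "majorant \<omega>" "s \<in> {0..<1}"
  shows "(1 - s) * (\<omega> (1 / (1 - s)))\<^sup>2 \<le> \<omega> 1 * \<omega> (1 / (1 - s))"
proof -
  define t where "t = 1 / (1 - s)"
  have t: "1 \<le> t" using assms(2) by (simp add: t_def)
  have "antimono_on {0<..} (\<lambda>t. \<omega> t / t)"
    using assms(1) by (simp add: majorant_def)
  then have "\<omega> t / t \<le> \<omega> 1 / 1"
    by (rule monotone_onD) (use t in auto)
  then have "\<omega> t / t * \<omega> t \<le> \<omega> 1 * \<omega> t"
    using majorant_nonneg[OF assms(1), of t] t by (intro mult_right_mono) auto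
  then show ?thesis
    using assms(2) by (simp add: t_def power2_eq_square mult_ac)
qed

lemma majorant_integral:
  assumes "majorant \<omega>" "r < 1"
  shows "(\<lambda>\<rho>. \<omega> (1 / (1 - \<rho>))) integrable_on {0..r}"
    and "0 \<le> integral {0..r} (\<lambda>\<rho>. \<omega> (1 / (1 - \<rho>)))"
proof -
  have c: "continuous_on {0..} \<omega>"
    using assms(1) by (simp add: majorant_def)
  have "continuous_on {0..r} (\<lambda>\<rho>. \<omega> (1 / (1 - \<rho>)))"
  proof (rule continuous_on_compose2[OF c])
    show "continuous_on {0..r} (\<lambda>\<rho>. 1 / (1 - \<rho>))"
      by (intro continuous_intros) (use assms(2) in auto)
  qed (use assms(2) in auto)
  then show i: "(\<lambda>\<rho>. \<omega> (1 / (1 - \<rho>))) integrable_on {0..r}"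
    by (rule integrable_continuous_real)
  show "0 \<le> integral {0..r} (\<lambda>\<rho>. \<omega> (1 / (1 - \<rho>)))"
    by (rule Henstock_Kurzweil_Integration.integral_nonneg[OF i])
       (use assms majorant_nonneg in auto)
qed

text \<open>The pointwise algebra relating the weighted divergence to the hyperbolic Laplacian:
  \<open>v\<close> is \<open>1 - |x|^2\<close>, \<open>W\<close> its power n - 2, \<open>c\<close>
  is n - 2, \<open>L\<close> the Euclidean Laplacian and \<open>S\<close> the product of gradient
  and position. Keeping \<open>W\<close> opaque removes exponents from the computation.\<close>

lemma hyperbolic_divergence_identity:
  fixes W v :: real
  assumes "W \<noteq> 0" "v \<noteq> 0"
  shows "P / W * L + P * 2 * c / (W * v) * S = P / (W * v\<^sup>2) * (v * (v * L + 2 * c * S))"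
proof -
  have "P / (W * v\<^sup>2) * (v * (v * L + 2 * c * S)) = P / (W * v\<^sup>2) * v\<^sup>2 * L + P / (W * v\<^sup>2) * v * (2 * c * S)"
    by (simp add: power2_eq_square distrib_left mult_ac)
  also have "P / (W * v\<^sup>2) * v\<^sup>2 = P / W"
    using assms by simp
  also have "P / (W * v\<^sup>2) * v = P / (W * v)"
    using assms by (simp add: power2_eq_square)
  finally show ?thesis
    by simp
qed

section \<open>The p-th power of a solution\<close>

locale hyperbolic_solution =
  fixes n :: nat and p :: real and l f :: "(nat \<Rightarrow> real) \<Rightarrow> real"
  assumes n: "2 \<le> n" and p: "2 \<le> p"
    and l: "continuous_on (unit_ball n) l" and l_nonneg: "\<And>x. x \<in> unit_ball n \<Longrightarrow> 0 \<le> l x"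
    and f: "Ck_on n 2 (unit_ball n) f"
    and eqn: "\<And>x. x \<in> unit_ball n \<Longrightarrow> hyp_laplacian n f x = l x * f x"
begin

lemmas f_cont = Ck_on_2D(1)[OF f]
lemmas f_partial = Ck_on_2D(2)[OF f]
lemmas partial_cont = Ck_on_2D(3)[OF f]
lemmas f_partial2 = Ck_on_2D(4)[OF f]
lemmas partial2_cont = Ck_on_2D(5)[OF f]

definition "w x = 1 - (vnorm n x)\<^sup>2"
definition "u x = \<bar>f x\<bar> powr p"
text \<open>\<open>p * q x\<close> is the derivative of the p-th power of the absolute value at
  \<open>f x\<close>. Thus \<open>G\<close> is the gradient of \<open>u\<close>, and
  \<open>D i\<close> is the product rule for \<open>G i / w ^ (n - 2)\<close>, its last term coming
  from the weight.\<close>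

definition "q x = sgn (f x) * \<bar>f x\<bar> powr (p - 1)"
definition "G i x = p * q x * partial i f x"
definition "D i x = (p * (p - 1) * pow_deriv2 p (f x) * (partial i f x)\<^sup>2 + p * q x * partial i (partial i f) x) / w x ^ (n - 2)
   + G i x * (2 * real (n - 2) * x i / w x ^ (n - 1))"

lemma n_gt_0: "0 < n" using n by simp

lemma w_pos: "x \<in> unit_ball n \<Longrightarrow> 0 < w x"
  by (simp add: w_def unit_ball_def abs_square_less_1)

lemma q_cont: "continuous_on (unit_ball n) q"
  unfolding q_def by (rule continuous_on_sgn_abs_powr[OF p f_cont])

lemma u_cont: "continuous_on (unit_ball n) u"
  unfolding u_def using p by (intro continuous_on_abs_powr f_cont) simp

lemma w_cont: "continuous_on A w"
  unfolding w_def by (intro continuous_intros)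

lemma G_cont: "i < n \<Longrightarrow> continuous_on (unit_ball n) (G i)"
  unfolding G_def by (intro continuous_on_mult continuous_on_const q_cont partial_cont)

lemma D_cont:
  assumes "i < n"
  shows "continuous_on (unit_ball n) (D i)"
proof -
  have "\<forall>x\<in>unit_ball n. w x ^ k \<noteq> 0" for k
    using w_pos by fastforce
  then show ?thesis
    unfolding D_def
    by (intro continuous_on_add continuous_on_mult continuous_on_divide continuous_on_power
        continuous_on_const continuous_on_coordinate continuous_on_pow_deriv2 p f_cont
        partial_cont partial2_cont q_cont w_cont G_cont assms)
qed

lemma u_has_partial:
  assumes "i < n" "x \<in> unit_ball n"
  shows "((\<lambda>t. u (x(i := t))) has_real_derivative G i x) (at (x i))"
proof -
  have "((\<lambda>t. \<bar>f (x(i := t))\<bar> powr p) has_real_derivative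
      p * (sgn (f (x(i := x i))) * \<bar>f (x(i := x i))\<bar> powr (p - 1)) * partial i f x) (at (x i))"
    by (rule DERIV_chain2[OF abs_powr_deriv1[OF p] f_partial[OF assms]])
  then show ?thesis
    by (simp add: u_def G_def q_def)
qed

lemma G_has_partial:
  assumes "i < n" "x \<in> unit_ball n"
  shows "((\<lambda>t. G i (x(i := t)) / (1 - (vnorm n (x(i := t)))\<^sup>2) ^ (n - 2)) has_real_derivative D i x) (at (x i))"
proof -
  define A where "A = (\<Sum>j\<in>{..<n}-{i}. (x j)\<^sup>2)"
  have A: "(vnorm n (x(i := t)))\<^sup>2 = A + t\<^sup>2" for t
    unfolding A_def by (rule vnorm_square_upd[OF assms(1)])
  have Ax: "(vnorm n x)\<^sup>2 = A + (x i)\<^sup>2"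
    using A[of "x i"] by simp
  have dq: "((\<lambda>t. q (x(i := t))) has_real_derivative (p - 1) * pow_deriv2 p (f x) * partial i f x) (at (x i))"
    using DERIV_chain2[OF abs_powr_deriv2[OF p] f_partial[OF assms]] by (simp add: q_def)
  have dG: "((\<lambda>t. G i (x(i := t))) has_real_derivative
      p * ((p - 1) * pow_deriv2 p (f x) * partial i f x * partial i f x + partial i (partial i f) x * q x)) (at (x i))"
    using DERIV_cmult[OF DERIV_mult[OF dq f_partial2[OF assms]], of p]
    by (simp add: G_def mult.assoc)
  have "A + (x i)\<^sup>2 < 1"
    using w_pos[OF assms(2)] by (simp add: w_def Ax)
  from DERIV_mult[OF dG hyperbolic_weight_has_derivative[OF this, of "n - 2"]]
  have "((\<lambda>t. G i (x(i := t)) / (1 - (vnorm n (x(i := t)))\<^sup>2) ^ (n - 2)) has_real_derivative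
      p * ((p - 1) * pow_deriv2 p (f x) * partial i f x * partial i f x + partial i (partial i f) x * q x)
        * (1 / (1 - (A + (x i)\<^sup>2)) ^ (n - 2))
      + 2 * real (n - 2) * x i / (1 - (A + (x i)\<^sup>2)) ^ (n - 2 + 1) * G i x) (at (x i))"
    by (simp add: A)
  then show ?thesis
  proof (rule DERIV_cong)
    have "1 - (A + (x i)\<^sup>2) = w x" "n - 2 + 1 = n - 1"
      using n by (simp_all add: w_def Ax)
    then show "p * ((p - 1) * pow_deriv2 p (f x) * partial i f x * partial i f x + partial i (partial i f) x * q x)
        * (1 / (1 - (A + (x i)\<^sup>2)) ^ (n - 2))
      + 2 * real (n - 2) * x i / (1 - (A + (x i)\<^sup>2)) ^ (n - 2 + 1) * G i x = D i x"
      by (simp only: D_def) (simp add: power2_eq_square add_divide_distrib distrib_left mult_ac)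
  qed
qed

sublocale radial_green n u G D
  by unfold_locales (use n u_cont G_cont D_cont u_has_partial G_has_partial in auto)

text \<open>The terms with second derivatives of f and those from the weight combine to
  \<open>p * q x / w x ^ n\<close> times the hyperbolic Laplacian of f. There the equation enters,
  and \<open>q x * f x = u x\<close> turns the result into a multiple of \<open>u x\<close>.\<close>

lemma sum_D:
  assumes x: "x \<in> unit_ball n"
  shows "(\<Sum>i<n. D i x) = p * (p - 1) / w x ^ (n - 2) * (pow_deriv2 p (f x) * (vnorm n (grad n f x))\<^sup>2)
     + p / w x ^ n * (l x * u x)"
proof -
  have w: "w x \<noteq> 0" using w_pos[OF x] by simp
  have "w x ^ n = w x ^ (n - 2) * (w x)\<^sup>2" "w x ^ (n - 1) = w x ^ (n - 2) * w x"
  proof -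
    have "n - 2 + 2 = n" "n - 2 + 1 = n - 1"
      using n by simp_all
    with power_add[of "w x" "n - 2" 2] power_add[of "w x" "n - 2" 1]
    show "w x ^ n = w x ^ (n - 2) * (w x)\<^sup>2" "w x ^ (n - 1) = w x ^ (n - 2) * w x"
      by (simp_all only: power_one_right)
  qed
  note pw = this
  have g: "(\<Sum>i<n. (partial i f x)\<^sup>2) = (vnorm n (grad n f x))\<^sup>2"
    by (simp add: vnorm_square grad_def)
  have h: "w x * (w x * laplacian n f x + 2 * (real n - 2) * (\<Sum>i<n. partial i f x * x i)) = l x * f x"
    using eqn[OF x] by (simp add: hyp_laplacian_def w_def vinner_def grad_def)
  have "(\<Sum>i<n. D i x) = (\<Sum>i<n. p * (p - 1) * pow_deriv2 p (f x) / w x ^ (n - 2) * (partial i f x)\<^sup>2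
      + p * q x / w x ^ (n - 2) * partial i (partial i f) x
      + p * q x * 2 * real (n - 2) / w x ^ (n - 1) * (partial i f x * x i))"
    by (rule sum.cong) (simp_all add: D_def G_def add_divide_distrib)
  also have "\<dots> = p * (p - 1) * pow_deriv2 p (f x) / w x ^ (n - 2) * (vnorm n (grad n f x))\<^sup>2
      + (p * q x / w x ^ (n - 2) * laplacian n f x
      + p * q x * 2 * real (n - 2) / w x ^ (n - 1) * (\<Sum>i<n. partial i f x * x i))"
    by (simp only: sum.distrib sum_distrib_left[symmetric] g laplacian_def add.assoc)
  also have "p * q x / w x ^ (n - 2) * laplacian n f x
      + p * q x * 2 * real (n - 2) / w x ^ (n - 1) * (\<Sum>i<n. partial i f x * x i)
    = p * q x / w x ^ n * (w x * (w x * laplacian n f x + 2 * (real n - 2) * (\<Sum>i<n. partial i f x * x i)))"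
  proof -
    have n2: "real (n - 2) = real n - 2"
      using n by (simp add: of_nat_diff)
    have "w x ^ (n - 2) \<noteq> 0"
      using w by simp
    then show ?thesis
      unfolding pw n2 by (rule hyperbolic_divergence_identity[OF _ w])
  qed
  also have "\<dots> = p / w x ^ n * (l x * u x)"
  proof -
    have "q x * f x = u x"
      by (simp add: q_def u_def sgn_abs_powr_mult)
    then show ?thesis
      unfolding h by (simp add: mult_ac)
  qed
  finally show ?thesis
    by (simp add: algebra_simps)
qed

lemma sum_D_nonneg:
  assumes "x \<in> unit_ball n"
  shows "0 \<le> (\<Sum>i<n. D i x)"
  unfolding sum_D[OF assms] using w_pos[OF assms] l_nonneg[OF assms] p
  by (intro add_nonneg_nonneg mult_nonneg_nonneg divide_nonneg_nonneg zero_le_power)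
     (auto simp: pow_deriv2_def u_def)

section \<open>Mean values of the divergence and the final estimate\<close>

abbreviation "grad_mean \<equiv> sphere_mean n (\<lambda>x. vnorm n (grad n f x) powr p)"

lemma grad_powr_cont: "continuous_on (unit_ball n) (\<lambda>x. vnorm n (grad n f x) powr p)"
proof -
  have "vnorm n (grad n f x) = sqrt (\<Sum>i<n. (partial i f x)\<^sup>2)" for x
    by (simp add: vnorm_def L2_set_def grad_def)
  then have "continuous_on (unit_ball n) (\<lambda>x. vnorm n (grad n f x))"
    by (simp only:) (intro continuous_on_real_sqrt continuous_on_sum continuous_on_power partial_cont, simp)
  then show ?thesis
    using p by (intro continuous_on_powr' continuous_on_const) auto
qed

text \<open>Young's inequality, normalised by m and a bound for the gradient mean, leaves a bracket
  whose mean is at most \<open>(1 - 2 / p) + 2 / p = 1\<close>; this gives the same bound as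
  Hoelder's inequality. That m only dominates the mean at s allows it to be taken at a larger
  radius.\<close>

lemma mean_Laplacian_le:
  assumes s: "s \<in> {0..<1}" and m: "0 < m" "mean s \<le> m powr p" and c: "0 \<le> c" "grad_mean s \<le> c powr p"
  shows "sphere_mean n (\<lambda>x. \<Sum>i<n. D i x) s
     \<le> p * (p - 1) / (1 - s\<^sup>2) ^ (n - 2) * (m powr (p - 2) * c\<^sup>2)
       + p * m powr p * radial_sup n l s / (1 - s\<^sup>2) ^ n"
proof -
  define S where "S = radial_sup n l s"
  define k where "k = 1 - s\<^sup>2"
  have k: "0 < k"
    using s by (simp add: k_def abs_square_less_1)
  obtain z where "z \<in> unit_sphere n"
    using unit_sphere_nonempty[OF n_gt_0] by blast
  then have "0 \<le> l (vscale s z)" "l (vscale s z) \<le> S"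
    using vscale_unit_sphere_in_unit_ball[of z n s] s l_nonneg le_radial_sup[OF n_gt_0 l, of "vscale s z"]
    by (simp_all add: S_def vnorm_vscale unit_sphere_def)
  then have S: "0 \<le> S" by simp
  \<comment> \<open>Young's inequality divides by the p-th power of the gradient bound, and c may be
    0. The estimate is proved for every b > c and b then tends to c.\<close>
  have bound: "sphere_mean n (\<lambda>x. \<Sum>i<n. D i x) s
     \<le> p * (p - 1) / k ^ (n - 2) * (m powr (p - 2) * b\<^sup>2) + p * m powr p * S / k ^ n" if b: "c < b" for b
  proof -
    have b0: "0 < b" using b c by simp
    define K where "K = p * (p - 1) / k ^ (n - 2)"
    define N where "N = m powr (p - 2) * b\<^sup>2"
    define a1 where "a1 = (1 - 2 / p) / m powr p"
    define b1 where "b1 = 2 / p / b powr p"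
    define q1 where "q1 = p / k ^ n"
    define \<alpha> where "\<alpha> = K * N * a1 + q1 * S"
    define \<beta> where "\<beta> = K * N * b1"
    have pos: "0 \<le> K" "0 \<le> N" "0 \<le> a1" "0 \<le> b1" "0 \<le> q1"
      using p k by (simp_all add: K_def N_def a1_def b1_def q1_def)
    have "sphere_mean n (\<lambda>x. \<Sum>i<n. D i x) s \<le> sphere_mean n (\<lambda>x. \<alpha> * u x + \<beta> * vnorm n (grad n f x) powr p) s"
    proof (rule sphere_mean_mono[OF continuous_D _ s])
      show "continuous_on (unit_ball n) (\<lambda>x. \<alpha> * u x + \<beta> * vnorm n (grad n f x) powr p)"
        by (intro continuous_on_add continuous_on_mult continuous_on_const u_cont grad_powr_cont)
      fix x assume x: "x \<in> unit_ball n" "vnorm n x = s"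
      have wk: "w x = k"
        by (simp add: w_def k_def x)
      have "pow_deriv2 p (f x) * (vnorm n (grad n f x))\<^sup>2
          \<le> N * (a1 * u x + b1 * vnorm n (grad n f x) powr p)"
        unfolding N_def a1_def b1_def u_def by (rule pow_deriv2_young[OF p m(1) b0 vnorm_nonneg])
      then have "K * (pow_deriv2 p (f x) * (vnorm n (grad n f x))\<^sup>2)
          \<le> K * (N * (a1 * u x + b1 * vnorm n (grad n f x) powr p))"
        using pos(1) by (rule mult_left_mono)
      moreover have "q1 * (l x * u x) \<le> q1 * (S * u x)"
        using le_radial_sup[OF n_gt_0 l x(1)] pos(5) x(2)
        by (intro mult_left_mono mult_right_mono) (auto simp: S_def u_def)
      moreover have "(\<Sum>i<n. D i x) = K * (pow_deriv2 p (f x) * (vnorm n (grad n f x))\<^sup>2) + q1 * (l x * u x)"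
        unfolding sum_D[OF x(1)] wk K_def q1_def ..
      ultimately show "(\<Sum>i<n. D i x) \<le> \<alpha> * u x + \<beta> * vnorm n (grad n f x) powr p"
        unfolding \<alpha>_def \<beta>_def by (simp add: algebra_simps)
    qed
    also have "\<dots> = \<alpha> * mean s + \<beta> * grad_mean s"
      by (subst sphere_mean_add)
         (use s in \<open>auto simp: sphere_mean_cmult intro!: continuous_on_mult continuous_on_const u_cont grad_powr_cont\<close>)
    also have "\<dots> \<le> \<alpha> * m powr p + \<beta> * b powr p"
    proof (intro add_mono mult_left_mono)
      show "mean s \<le> m powr p" by fact
      have "c powr p \<le> b powr p"
        using c b p by (intro powr_mono2) auto
      then show "grad_mean s \<le> b powr p"
        using c by simp
      show "0 \<le> \<alpha>" "0 \<le> \<beta>"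
        unfolding \<alpha>_def \<beta>_def using pos S by simp_all
    qed
    also have "\<dots> = K * N * (a1 * m powr p + b1 * b powr p) + q1 * S * m powr p"
      by (simp add: \<alpha>_def \<beta>_def algebra_simps)
    also have "a1 * m powr p + b1 * b powr p = 1"
      using m b0 by (simp add: a1_def b1_def)
    finally show ?thesis
      by (simp add: K_def N_def q1_def mult_ac)
  qed
  have "((\<lambda>b. p * (p - 1) / k ^ (n - 2) * (m powr (p - 2) * b\<^sup>2) + p * m powr p * S / k ^ n) \<longlongrightarrow>
      p * (p - 1) / k ^ (n - 2) * (m powr (p - 2) * c\<^sup>2) + p * m powr p * S / k ^ n) (at_right c)"
    by (intro tendsto_intros)
  moreover have "\<forall>\<^sub>F b in at_right c. sphere_mean n (\<lambda>x. \<Sum>i<n. D i x) s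
     \<le> p * (p - 1) / k ^ (n - 2) * (m powr (p - 2) * b\<^sup>2) + p * m powr p * S / k ^ n"
    using bound by (auto simp: eventually_at_filter)
  ultimately show ?thesis
    unfolding k_def[symmetric] S_def[symmetric] by (rule tendsto_lowerbound) simp
qed

text \<open>Continuity of the kernel at 0 and of the radial supremum ensure that
  \<open>green_potential\<close> is a genuine integral and not the default value 0.\<close>

lemma green_potential_integrable:
  assumes "0 \<le> r" "r < 1"
  shows "(\<lambda>\<rho>. \<rho> ^ (n - 1) * hyp_green n \<rho> r * radial_sup n l \<rho> / (1 - \<rho>\<^sup>2) ^ n) integrable_on {0..r}"
proof -
  have k: "continuous_on {0..r} (\<lambda>\<rho>. \<rho> ^ (n - 1) * hyp_green n \<rho> r)"
    by (rule continuous_on_green_kernel[OF n assms])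
  have s: "continuous_on {0..r} (radial_sup n l)"
    by (rule continuous_on_subset[OF continuous_on_radial_sup[OF n_gt_0 l]]) (use assms in auto)
  have c: "continuous_on {0..r} (\<lambda>\<rho>. (1 - \<rho>\<^sup>2) ^ n)"
    by (intro continuous_intros)
  have "(1 - \<rho>\<^sup>2) ^ n \<noteq> 0" if "\<rho> \<in> {0..r}" for \<rho>
  proof -
    have "\<rho>\<^sup>2 < 1"
      using assms that by (simp add: abs_square_less_1)
    then show ?thesis by simp
  qed
  then show ?thesis
    by (intro integrable_continuous_real continuous_on_divide[OF continuous_on_mult[OF k s] c] ballI)
qed

lemma Mp_f: "Mp n abs p r f = mean r powr (1 / p)"
  by (simp add: Mp_def sphere_mean_def u_def[abs_def])

lemma Mp_grad: "Mp n (vnorm n) p r (grad n f) = grad_mean r powr (1 / p)"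
  by (simp add: Mp_def sphere_mean_def)

text \<open>Stated in multiplied form; the division by \<open>C1 n p l r\<close>, where the
  smallness of the Green potential enters, is left to the theorem.\<close>

lemma Mp_bound:
  assumes C: "0 < C" and \<omega>: "majorant \<omega>"
    and grad: "\<And>r. r \<in> {0..<1} \<Longrightarrow> Mp n (vnorm n) p r (grad n f) \<le> C * \<omega> (1 / (1 - r))"
    and r: "r \<in> {0..<1}"
  shows "C1 n p l r * (Mp n abs p r f)\<^sup>2 \<le> \<bar>f (\<lambda>_. 0)\<bar>\<^sup>2 +
     p * C\<^sup>2 * \<omega> 1 * (p - 1) / (real n - 1) * integral {0..r} (\<lambda>\<rho>. \<omega> (1 / (1 - \<rho>)))"
proof -
  define m where "m = Mp n abs p r f"
  define T where "T = p * C\<^sup>2 * \<omega> 1 * (p - 1) / (real n - 1)"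
  define W where "W = integral {0..r} (\<lambda>\<rho>. \<omega> (1 / (1 - \<rho>)))"
  have r01: "0 \<le> r" "r < 1" using r by auto
  note \<omega>0 = majorant_nonneg[OF \<omega>]
  have T: "0 \<le> T"
    using p n \<omega>0[of 1] by (simp add: T_def)
  note Wi = majorant_integral(1)[OF \<omega> r01(2)]
  have W: "0 \<le> W"
    unfolding W_def by (rule majorant_integral(2)[OF \<omega> r01(2)])
  have mean0: "0 \<le> mean s" if "s \<in> {0..<1}" for s
    by (rule sphere_mean_nonneg[OF that]) (simp add: u_def)
  have gmean0: "0 \<le> grad_mean s" if "s \<in> {0..<1}" for s
    by (rule sphere_mean_nonneg[OF that]) simp
  show ?thesis
  \<comment> \<open>For m = 0 the left side is 0. Otherwise \<open>m powr (p - 2)\<close> is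
    positive and can be cancelled at the end.\<close>
  proof (cases "m = 0")
    case True
    then show ?thesis
      using T W by (simp add: m_def[symmetric] T_def[symmetric] W_def[symmetric])
  next
    case False
    then have m: "0 < m"
      by (simp add: m_def Mp_f)
    have mp: "m powr p = mean r"
      using mean0[OF r] p by (simp add: m_def Mp_f powr_powr)
    let ?K = "\<lambda>\<rho>. \<rho> ^ (n - 1) * hyp_green n \<rho> r * radial_sup n l \<rho> / (1 - \<rho>\<^sup>2) ^ n"
    have Kint: "(?K has_integral green_potential n l r) {0..r}"
      unfolding green_potential_def by (rule integrable_integral[OF green_potential_integrable[OF r01]])
    have rhs: "((\<lambda>s. m powr (p - 2) * T * \<omega> (1 / (1 - s)) + real n * p * m powr p * ?K s) has_integral
        m powr (p - 2) * T * W + real n * p * m powr p * green_potential n l r) {0..r}"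
      unfolding W_def by (intro has_integral_add has_integral_mult_right integrable_integral[OF Wi] Kint)
    have le: "n * (s ^ (n - 1) * hyp_green n s r) * sphere_mean n (\<lambda>x. \<Sum>i<n. D i x) s
       \<le> m powr (p - 2) * T * \<omega> (1 / (1 - s)) + real n * p * m powr p * ?K s" if s: "s \<in> {0..r}" for s
    proof (cases "s = 0")
      case True
      have z: "(0::real) ^ (n - Suc 0) = 0"
        using n by simp
      show ?thesis
        using T \<omega>0[of 1] by (simp add: True z)
    next
      case False
      then have s01: "0 < s" "s \<le> r" "s < 1" "s \<in> {0..<1}"
        using s r01 by auto
      define c where "c = C * \<omega> (1 / (1 - s))"
      have c0: "0 \<le> c"
        using C \<omega>0[of "1 / (1 - s)"] s01 by (simp add: c_def)
      have "grad_mean s = (grad_mean s powr (1 / p)) powr p"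
        using gmean0[OF s01(4)] p by (simp add: powr_powr)
      also have "\<dots> \<le> c powr p"
        using grad[OF s01(4)] p unfolding Mp_grad c_def by (intro powr_mono2) auto
      finally have gc: "grad_mean s \<le> c powr p" .
      \<comment> \<open>Monotonicity of the mean replaces s by r, so the potential term integrates
        to a multiple of \<open>m powr p\<close> and can be moved into \<open>C1\<close>.\<close>
      have "mean s \<le> m powr p"
        unfolding mp using mean_mono[OF sum_D_nonneg] s01 r01 by auto
      note L = mean_Laplacian_le[OF s01(4) m this c0 gc]
      define k where "k = 1 - s\<^sup>2"
      have k: "0 < k"
        using s01 by (simp add: k_def abs_square_less_1)
      define g where "g = s ^ (n - 1) * hyp_green n s r"
      have g: "0 \<le> g"
        unfolding g_def using hyp_green_nonneg[of s r n] s01 r01 by simp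
      have "n * g * sphere_mean n (\<lambda>x. \<Sum>i<n. D i x) s
         \<le> n * g * (p * (p - 1) / k ^ (n - 2) * (m powr (p - 2) * c\<^sup>2) + p * m powr p * radial_sup n l s / k ^ n)"
        using L g unfolding k_def by (intro mult_left_mono) auto
      also have "\<dots> = n * g * (p * (p - 1) / k ^ (n - 2) * (m powr (p - 2) * c\<^sup>2)) + real n * p * m powr p * ?K s"
        by (simp add: g_def k_def algebra_simps)
      also have "n * g * (p * (p - 1) / k ^ (n - 2) * (m powr (p - 2) * c\<^sup>2)) \<le> m powr (p - 2) * T * \<omega> (1 / (1 - s))"
      proof -
        \<comment> \<open>The factor \<open>k ^ (n - 2)\<close> cancels the weight in the gradient
          term exactly; the remaining \<open>1 - s\<close> is spent on the majorant.\<close>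
        have "n * g \<le> k ^ (n - 2) * (1 - s) / (real n - 1)"
          using hyp_green_upper[OF n s01(1,2) r01(2)] by (simp add: g_def k_def mult.assoc)
        then have "n * g * (p * (p - 1) / k ^ (n - 2) * (m powr (p - 2) * c\<^sup>2))
          \<le> k ^ (n - 2) * (1 - s) / (real n - 1) * (p * (p - 1) / k ^ (n - 2) * (m powr (p - 2) * c\<^sup>2))"
          using p k by (intro mult_right_mono) auto
        also have "\<dots> = m powr (p - 2) * (p * (p - 1) / (real n - 1) * C\<^sup>2) * ((1 - s) * (\<omega> (1 / (1 - s)))\<^sup>2)"
          using k by (simp add: c_def power_mult_distrib)
        also have "\<dots> \<le> m powr (p - 2) * (p * (p - 1) / (real n - 1) * C\<^sup>2) * (\<omega> 1 * \<omega> (1 / (1 - s)))"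
          using majorant_square_le[OF \<omega> s01(4)] p n by (intro mult_left_mono) auto
        also have "\<dots> = m powr (p - 2) * T * \<omega> (1 / (1 - s))"
          by (simp add: T_def)
        finally show ?thesis .
      qed
      finally show ?thesis
        by (simp add: g_def)
    qed
    have "mean r - u (\<lambda>_. 0) \<le> m powr (p - 2) * T * W + real n * p * m powr p * green_potential n l r"
      by (rule has_integral_le[OF green_formula[OF r01] rhs le])
    then have "C1 n p l r * m powr p \<le> u (\<lambda>_. 0) + m powr (p - 2) * T * W"
      unfolding mp[symmetric] C1_def by (simp add: algebra_simps)
    \<comment> \<open>The mean at 0 is the value at 0, so monotonicity gives
      \<open>\<bar>f (\<lambda>_. 0)\<bar> \<le> m\<close>; the exponent p is split as (p - 2) + 2.
      The value f(0) = 0 is set apart because \<open>0 powr 0 = 0\<close> spoils this splitting for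
      p = 2.\<close>
    also have "u (\<lambda>_. 0) \<le> m powr (p - 2) * \<bar>f (\<lambda>_. 0)\<bar>\<^sup>2"
    proof (cases "f (\<lambda>_. 0) = 0")
      case False
      have "\<bar>f (\<lambda>_. 0)\<bar> powr p \<le> m powr p"
        unfolding mp using mean_mono[OF sum_D_nonneg, of 0 r] r01
        by (simp add: sphere_mean_zero[OF n_gt_0] u_def)
      then have "\<bar>f (\<lambda>_. 0)\<bar> \<le> m"
        using powr_less_mono2[of p m "\<bar>f (\<lambda>_. 0)\<bar>"] p m by linarith
      then have "\<bar>f (\<lambda>_. 0)\<bar> powr (p - 2) \<le> m powr (p - 2)"
        using p by (intro powr_mono2) auto
      moreover have "u (\<lambda>_. 0) = \<bar>f (\<lambda>_. 0)\<bar> powr (p - 2) * \<bar>f (\<lambda>_. 0)\<bar>\<^sup>2"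
        using False powr_add[of "\<bar>f (\<lambda>_. 0)\<bar>" "p - 2" 2] by (simp add: u_def)
      ultimately show ?thesis
        by (simp add: mult_right_mono)
    qed (simp add: u_def)
    finally have "m powr (p - 2) * (C1 n p l r * m\<^sup>2) \<le> m powr (p - 2) * (\<bar>f (\<lambda>_. 0)\<bar>\<^sup>2 + T * W)"
      using powr_add[of m "p - 2" 2] m by (simp add: algebra_simps)
    then show ?thesis
      using m by (simp add: m_def[symmetric] T_def[symmetric] W_def[symmetric])
  qed
qed

end

theorem corollary1p6:
  fixes C :: real
  assumes "C > 0"
  shows "\<exists>C'>0. \<forall>(n::nat) (p::real) (\<omega>::real \<Rightarrow> real) (l::(nat \<Rightarrow> real) \<Rightarrow> real) (f::(nat \<Rightarrow> real) \<Rightarrow> real).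
    n \<ge> 2 \<longrightarrow> p \<ge> 2 \<longrightarrow> majorant \<omega> \<longrightarrow>
    continuous_on (unit_ball n) l \<longrightarrow> (\<forall>x\<in>unit_ball n. 0 \<le> l x) \<longrightarrow>
    (\<forall>r\<in>{0..<1}. green_potential n l r < 1 / (real n * p)) \<longrightarrow>
    Ck_on n 2 (unit_ball n) f \<longrightarrow>
    (\<forall>x\<in>unit_ball n. hyp_laplacian n f x = l x * f x) \<longrightarrow>
    (\<forall>r\<in>{0..<1}. Mp n (vnorm n) p r (grad n f) \<le> C * \<omega> (1 / (1 - r))) \<longrightarrow>
    (\<forall>r\<in>{0..<1}. Mp n abs p r f \<le>
       1 / sqrt (C1 n p l r) *
       sqrt (\<bar>f (\<lambda>_. 0)\<bar>\<^sup>2 +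
             2 ^ (n - 2) * p * C' * \<omega> 1 * (p - 1) / (real n - 1) *
             integral {0..r} (\<lambda>\<rho>. \<omega> (1 / (1 - \<rho>)))))"
proof (intro exI[of _ "C\<^sup>2"] conjI allI impI ballI)
  show "0 < C\<^sup>2" using assms by simp
  fix n :: nat and p :: real and \<omega> :: "real \<Rightarrow> real" and l f :: "(nat \<Rightarrow> real) \<Rightarrow> real" and r :: real
  assume n: "n \<ge> 2" and p: "p \<ge> 2" and \<omega>: "majorant \<omega>"
    and l: "continuous_on (unit_ball n) l" "\<forall>x\<in>unit_ball n. 0 \<le> l x"
    and gp: "\<forall>r\<in>{0..<1}. green_potential n l r < 1 / (real n * p)"
    and f: "Ck_on n 2 (unit_ball n) f" "\<forall>x\<in>unit_ball n. hyp_laplacian n f x = l x * f x"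
    and grad: "\<forall>r\<in>{0..<1}. Mp n (vnorm n) p r (grad n f) \<le> C * \<omega> (1 / (1 - r))"
    and r: "r \<in> {0..<1}"
  interpret hyperbolic_solution n p l f
    by unfold_locales (use n p l f in auto)
  define E where "E = p * C\<^sup>2 * \<omega> 1 * (p - 1) / (real n - 1) * integral {0..r} (\<lambda>\<rho>. \<omega> (1 / (1 - \<rho>)))"
  define M where "M = Mp n abs p r f"
  have C1: "0 < C1 n p l r"
    using gp[rule_format, OF r] n p by (simp add: C1_def field_simps)
  note \<omega>0 = majorant_nonneg[OF \<omega>]
  have "0 \<le> integral {0..r} (\<lambda>\<rho>. \<omega> (1 / (1 - \<rho>)))"
    using majorant_integral(2)[OF \<omega>] r by simp
  then have E: "0 \<le> E"
    using \<omega>0[of 1] n p by (simp add: E_def)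
  have M0: "0 \<le> M" by (simp add: M_def Mp_def)
  have "C1 n p l r * M\<^sup>2 \<le> \<bar>f (\<lambda>_. 0)\<bar>\<^sup>2 + E"
    unfolding M_def E_def by (rule Mp_bound[OF assms \<omega> _ r]) (use grad in auto)
  \<comment> \<open>The kernel bound already yields the estimate with \<open>E\<close>; the factor
    \<open>2 ^ (n - 2)\<close>, at least 1, enters here to reach the stated form.\<close>
  also have "E \<le> 2 ^ (n - 2) * E"
    using E mult_right_mono[of 1 "2 ^ (n - 2)" E] by simp
  finally have "sqrt (C1 n p l r * M\<^sup>2) \<le> sqrt (\<bar>f (\<lambda>_. 0)\<bar>\<^sup>2 + 2 ^ (n - 2) * E)"
    by (simp only: real_sqrt_le_iff)
  then have "sqrt (C1 n p l r) * M \<le> sqrt (\<bar>f (\<lambda>_. 0)\<bar>\<^sup>2 + 2 ^ (n - 2) * E)"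
    using M0 by (simp add: real_sqrt_mult)
  then have "M \<le> 1 / sqrt (C1 n p l r) * sqrt (\<bar>f (\<lambda>_. 0)\<bar>\<^sup>2 + 2 ^ (n - 2) * E)"
    using C1 by (simp add: pos_le_divide_eq mult.commute)
  then show "Mp n abs p r f \<le> 1 / sqrt (C1 n p l r) *
       sqrt (\<bar>f (\<lambda>_. 0)\<bar>\<^sup>2 +
             2 ^ (n - 2) * p * C\<^sup>2 * \<omega> 1 * (p - 1) / (real n - 1) *
             integral {0..r} (\<lambda>\<rho>. \<omega> (1 / (1 - \<rho>))))"
    by (simp add: M_def E_def mult.assoc)
qed

end
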